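(* For every integer $\delta \geq 1$ there exists an integer $M$ such that for all integers $e,m$ with $3 \leq e < m$, $m-e=\delta$ and $m \geq M$, we have $\mathscr{R}(e,m) = \mathscr{C}(e,m)$. (In words: for each fixed value of $m-e$, $\mathscr{R}(e,m)=\mathscr{C}(e,m)$ for all $m \gg 0$.)
   Context: A numerical monoid is an additive submonoid $\Gamma\subseteq\mathbb{N}$ (containing $0$) with $\mathbb{N}\setminus\Gamma$ finite. It has a unique minimal set of generators $g_0<g_1<\cdots<g_e$; its embedding dimension is $\mathrm{edim}(\Gamma)=e+1$ and its multiplicity is $\mathrm{mult}(\Gamma)=g_0$. Let $\varphi:\mathbb{N}^{e+1}\to\mathbb{N}$, $\varphi(a_0,\dots,a_e)=\sum_i a_ig_i$, and let $\ker\varphi=\{(\mathbf a,\mathbf b)\in\mathbb{N}^{e+1}\times\mathbb{N}^{e+1}: \varphi(\mathbf a)=\varphi(\mathbf b)\}$ (a congruence on $\mathbb{N}^{e+1}$). The number of minimal relations $\rho(\Gamma)$ is the cardinality of a minimal generating set of the congruence $\ker\varphi$ (this is independent of the choice). Define $\mathscr{R}(e,m)=\max\{\rho(\Gamma): \mathrm{edim}(\Gamma)=e+1,\ \mathrm{mult}(\Gamma)=m\}$. For positive integers $n,d$ write the Macaulay expansion $n=\binom{n_d}{d}+\binom{n_{d-1}}{d-1}+\cdots+\binom{n_j}{j}$ with uniquely determined integers $n_d>n_{d-1}>\cdots>n_j\geq j\geq 1$, and set $n^{\langle d\rangle}=\binom{n_d+1}{d+1}+\binom{n_{d-1}+1}{d}+\cdots+\binom{n_j+1}{j+1}$;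 set $0^{\langle d\rangle}=0$. For integers $1<e<m$, let $r$ be the unique integer with $\binom{e+r-1}{r-1}\leq m<\binom{e+r}{r}$, let $s=m-\binom{e+r-1}{r-1}$, and define $\mathscr{C}(e,m)=\binom{e+r-1}{r}+s^{\langle r\rangle}-s$. *)

theory Defs
  imports Complex_Main
begin

definition add_submonoid :: "'a::comm_monoid_add set \<Rightarrow> bool" where
  "add_submonoid S \<longleftrightarrow> 0 \<in> S \<and> (\<forall>x\<in>S. \<forall>y\<in>S. x + y \<in> S)"

definition numerical_monoid :: "nat set \<Rightarrow> bool" where
  "numerical_monoid \<Gamma> \<longleftrightarrow> add_submonoid \<Gamma> \<and> finite (UNIV - \<Gamma>)"

text \<open>Minimality of a generating set is with respect to inclusion. The predicate \<open>P\<close> singles out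
  the closed sets (submonoids or congruences), so that \<open>P hull G\<close> is what \<open>G\<close> generates.\<close>

definition minimal_generating :: "('a set \<Rightarrow> bool) \<Rightarrow> 'a set \<Rightarrow> 'a set \<Rightarrow> bool" where
  "minimal_generating P X G \<longleftrightarrow> P hull G = X \<and> (\<forall>H. H \<subset> G \<longrightarrow> P hull H \<noteq> X)"

definition min_gens :: "nat set \<Rightarrow> nat set" where
  "min_gens \<Gamma> = (THE G. minimal_generating add_submonoid \<Gamma> G)"

definition edim :: "nat set \<Rightarrow> nat" where
  "edim \<Gamma> = card (min_gens \<Gamma>)"

definition mult :: "nat set \<Rightarrow> nat" where
  "mult \<Gamma> = Min (min_gens \<Gamma>)"

text \<open>The monoid \<open>\<nat>\<^sup>n\<close>: tuples indexed by \<open>0, \<dots>, n - 1\<close>, extended by zero.\<close>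

definition tuples :: "nat \<Rightarrow> (nat \<Rightarrow> nat) set" where
  "tuples n = {a. \<forall>i\<ge>n. a i = 0}"

definition tuple_congruence ::
    "nat \<Rightarrow> ((nat \<Rightarrow> nat) \<times> (nat \<Rightarrow> nat)) set \<Rightarrow> bool" where
  "tuple_congruence n R \<longleftrightarrow> equiv (tuples n) R \<and>
     (\<forall>a b c d. (a, b) \<in> R \<longrightarrow> (c, d) \<in> R \<longrightarrow> (\<lambda>i. a i + c i, \<lambda>i. b i + d i) \<in> R)"

definition gen :: "nat set \<Rightarrow> nat \<Rightarrow> nat" where
  "gen \<Gamma> i = sorted_list_of_set (min_gens \<Gamma>) ! i"

definition phi :: "nat set \<Rightarrow> (nat \<Rightarrow> nat) \<Rightarrow> nat" where
  "phi \<Gamma> a = (\<Sum>i<edim \<Gamma>. a i * gen \<Gamma> i)"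

definition ker_phi :: "nat set \<Rightarrow> ((nat \<Rightarrow> nat) \<times> (nat \<Rightarrow> nat)) set" where
  "ker_phi \<Gamma> = {(a, b) \<in> tuples (edim \<Gamma>) \<times> tuples (edim \<Gamma>). phi \<Gamma> a = phi \<Gamma> b}"

text \<open>All minimal generating sets of \<open>ker_phi \<Gamma>\<close> are finite and of the same cardinality, so the
  choice below is immaterial.\<close>

definition num_min_relations :: "nat set \<Rightarrow> nat" where
  "num_min_relations \<Gamma> =
     card (SOME S. minimal_generating (tuple_congruence (edim \<Gamma>)) (ker_phi \<Gamma>) S)"

definition max_relations :: "nat \<Rightarrow> nat \<Rightarrow> nat" where
  "max_relations e m =
     Max {num_min_relations \<Gamma> | \<Gamma>. numerical_monoid \<Gamma> \<and> edim \<Gamma> = e + 1 \<and> mult \<Gamma> = m}"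

definition macaulay_expansion :: "nat \<Rightarrow> nat \<Rightarrow> nat \<Rightarrow> (nat \<Rightarrow> nat) \<Rightarrow> bool" where
  "macaulay_expansion n d j k \<longleftrightarrow>
     1 \<le> j \<and> j \<le> d \<and> j \<le> k j \<and> (\<forall>i\<in>{j..<d}. k i < k (i + 1)) \<and>
     n = (\<Sum>i=j..d. k i choose i)"

text \<open>The description ranges over the value rather than over \<open>j\<close> and \<open>k\<close>, because the expansion
  determines \<open>k\<close> only on \<open>{j..d}\<close>.\<close>

definition macaulay_shift :: "nat \<Rightarrow> nat \<Rightarrow> nat" where
  "macaulay_shift n d =
     (if n = 0 then 0
      else THE v. \<exists>j k. macaulay_expansion n d j k \<and> v = (\<Sum>i=j..d. (k i + 1) choose (i + 1)))"

text \<open>For \<open>r = 0\<close> the lower index \<open>r - 1\<close> would be negative, so \<open>r \<ge> 1\<close> is required explicitly.\<close>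

definition macaulay_r :: "nat \<Rightarrow> nat \<Rightarrow> nat" where
  "macaulay_r e m =
     (THE r. 1 \<le> r \<and> (e + r - 1) choose (r - 1) \<le> m \<and> m < (e + r) choose r)"

definition macaulay_s :: "nat \<Rightarrow> nat \<Rightarrow> nat" where
  "macaulay_s e m = m - ((e + macaulay_r e m - 1) choose (macaulay_r e m - 1))"

definition relation_bound :: "nat \<Rightarrow> nat \<Rightarrow> int" where
  "relation_bound e m =
     int ((e + macaulay_r e m - 1) choose macaulay_r e m)
     + int (macaulay_shift (macaulay_s e m) (macaulay_r e m)) - int (macaulay_s e m)"

end

theory Submission
  imports Defs "HOL-Library.Multiset" "HOL-Library.Function_Algebras" "HOL-Library.Fun_Lexorder"
begin

text \<open>For \<open>m\<close> large compared with \<open>\<delta>\<close> one has \<open>r = 2\<close> and \<open>s = \<delta> - 1\<close>, so the claim is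
  \<open>max \<rho> = (e + 1 choose 2) + F s - s\<close> where \<open>F s = macaulay_shift s 2\<close>.

  Upper bound: order each fibre of \<open>\<phi>\<close> lexicographically, the coordinate of \<open>g\<^sub>0 = m\<close> being the
  most significant, and call the maximum of the fibre normal. Divisors of normal tuples are normal,
  and rewriting to normal form shows that a minimal generating set of the congruence has at most as
  many elements as there are minimal non-normal tuples. The normal tuples with vanishing \<open>0\<close>-th
  coordinate have pairwise distinct weights modulo \<open>m\<close>, so there are at most \<open>m\<close> of them: \<open>0\<close>, the
  \<open>e\<close> unit vectors and at most \<open>s\<close> of degree at least \<open>2\<close>. A bound of Macaulay type for
  order ideals of monomials then bounds the number of minimal non-normal tuples.

  Lower bound: take the generators \<open>m\<close>, \<open>3m + 3\<^sup>i\<close> for \<open>1 \<le> i \<le> a\<close>, and \<open>5m + c\<close> for the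
  residues \<open>c\<close> that are neither \<open>0\<close>, nor some \<open>3\<^sup>i\<close>, nor \<open>3\<^sup>i + 3\<^sup>j\<close> for one of \<open>s\<close> pairs
  forming a lexicographic segment. The corners of the resulting order ideal do not share
  support with any other element of their fibre, so each of them forces a relation of its own.\<close>

subsection \<open>The Macaulay shift in degree two\<close>

lemma Suc_choose_2: "Suc a choose 2 = (a choose 2) + a"
  by (simp add: numeral_2_eq_2)

lemma Suc_choose_3: "Suc a choose 3 = (a choose 3) + (a choose 2)"
  by (simp add: numeral_3_eq_3 numeral_2_eq_2)

lemma choose_2_plus_unique_aux:
  fixes a a' b b' :: nat
  assumes "(a choose 2) + b = (a' choose 2) + b'" "b < a"
  shows "a' \<le> a"
proof (rule ccontr)
  assume "\<not> a' \<le> a"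
  then have "(Suc a choose 2) \<le> (a' choose 2)"
    by (intro binomial_right_mono) auto
  with assms show False
    by (simp add: Suc_choose_2)
qed

text \<open>The intervals from \<open>a choose 2\<close> up to \<open>Suc a choose 2\<close> have
  length \<open>a\<close> and tile the naturals, so \<open>a\<close> names a block and
  \<open>b\<close> the offset inside it.\<close>

lemma choose_2_plus_unique:
  fixes a a' b b' :: nat
  assumes "(a choose 2) + b = (a' choose 2) + b'" "b < a" "b' < a'"
  shows "a = a' \<and> b = b'"
  using choose_2_plus_unique_aux[of a b a' b'] choose_2_plus_unique_aux[of a' b' a b] assms
  by fastforce

lemma choose_2_plus_exists:
  fixes n :: nat
  obtains a b where "n = (a choose 2) + b" "b < a"
proof -
  have "\<exists>a b. n = (a choose 2) + b \<and> b < a"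
  proof (induction n)
    case 0
    show ?case by (intro exI[of _ 1] exI[of _ 0]) auto
  next
    case (Suc n)
    then obtain a b where ab: "n = (a choose 2) + b" "b < a" by blast
    show ?case
    proof (cases "Suc b < a")
      case True
      then show ?thesis using ab by (intro exI[of _ a] exI[of _ "Suc b"]) auto
    next
      case False
      then have "Suc n = (Suc a choose 2) + 0" using ab by (simp add: Suc_choose_2)
      then show ?thesis by blast
    qed
  qed
  then show ?thesis using that by blast
qed

text \<open>An expansion has one term for \<open>j = 2\<close> and two for \<open>j = 1\<close>.
  Admitting \<open>b = 0\<close> covers both shapes by one pair, since \<open>Suc 0 choose 2\<close>
  vanishes.\<close>

lemma macaulay_expansion_2D:
  assumes "macaulay_expansion n 2 j k"
  obtains a b where "n = (a choose 2) + b" "b < a"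
    "(\<Sum>i=j..2. (k i + 1) choose (i + 1)) = (Suc a choose 3) + (Suc b choose 2)"
proof -
  have j: "j = 1 \<or> j = 2" using assms by (auto simp: macaulay_expansion_def)
  then show ?thesis
  proof
    assume j: "j = 1"
    have "{1..2} = {1, 2::nat}" by auto
    with assms j have "n = (k 2 choose 2) + k 1" "k 1 < k 2"
      "(\<Sum>i=j..2. (k i + 1) choose (i + 1)) = (Suc (k 2) choose 3) + (Suc (k 1) choose 2)"
      by (auto simp: macaulay_expansion_def numeral_3_eq_3 numeral_2_eq_2)
    then show ?thesis using that by blast
  next
    assume j: "j = 2"
    with assms have "n = (k 2 choose 2) + 0" "0 < k 2"
      "(\<Sum>i=j..2. (k i + 1) choose (i + 1)) = (Suc (k 2) choose 3) + (Suc 0 choose 2)"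
      by (auto simp: macaulay_expansion_def numeral_3_eq_3)
    then show ?thesis using that by blast
  qed
qed

lemma macaulay_expansion_2I:
  assumes "b < a" "(a choose 2) + b > 0"
  shows "\<exists>j k. macaulay_expansion ((a choose 2) + b) 2 j k"
proof (cases "b = 0")
  case True
  with assms have "a \<ge> 2" by (cases "a < 2") (auto simp: less_Suc_eq numeral_2_eq_2)
  then have "macaulay_expansion ((a choose 2) + b) 2 2 (\<lambda>_. a)"
    using True by (simp add: macaulay_expansion_def)
  then show ?thesis by blast
next
  case False
  have "{1..2} = {1, 2::nat}" "{1..<2} = {1::nat}" by auto
  then have "macaulay_expansion ((a choose 2) + b) 2 1 (\<lambda>i. if i = 1 then b else a)"
    using False assms by (simp add: macaulay_expansion_def)
  then show ?thesis by blast
qed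

lemma macaulay_shift_2_less:
  assumes "b < a"
  shows "macaulay_shift ((a choose 2) + b) 2 = (Suc a choose 3) + (Suc b choose 2)"
proof (cases "(a choose 2) + b = 0")
  case True
  then have "b = 0" "a choose 2 = 0" by auto
  then have "a < 2" by (simp add: binomial_eq_0_iff)
  then show ?thesis using \<open>b = 0\<close> by (simp add: macaulay_shift_def)
next
  case False
  obtain j k where jk: "macaulay_expansion ((a choose 2) + b) 2 j k"
    using macaulay_expansion_2I[OF assms] False by auto
  have val: "(\<Sum>i=j..2. (k i + 1) choose (i + 1)) = (Suc a choose 3) + (Suc b choose 2)"
    if e: "macaulay_expansion ((a choose 2) + b) 2 j k" for j k
  proof -
    obtain a' b' where *: "(a choose 2) + b = (a' choose 2) + b'" "b' < a'"
      "(\<Sum>i=j..2. (k i + 1) choose (i + 1)) = (Suc a' choose 3) + (Suc b' choose 2)"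
      using macaulay_expansion_2D[OF e] by blast
    with choose_2_plus_unique[OF *(1) assms *(2)] show ?thesis by simp
  qed
  have "(THE v. \<exists>j k. macaulay_expansion ((a choose 2) + b) 2 j k \<and>
      v = (\<Sum>i=j..2. (k i + 1) choose (i + 1))) = (Suc a choose 3) + (Suc b choose 2)"
  proof (rule the_equality)
    show "\<exists>j k. macaulay_expansion ((a choose 2) + b) 2 j k \<and>
      (Suc a choose 3) + (Suc b choose 2) = (\<Sum>i=j..2. (k i + 1) choose (i + 1))"
      using jk val[OF jk] by metis
  qed (use val in blast)
  then show ?thesis using False by (simp add: macaulay_shift_def)
qed

text \<open>The value \<open>b = a\<close> is the start of the next block, where Pascal's rule makes
  both descriptions agree. Including it avoids case distinctions when an offset grows by
  one.\<close>

lemma macaulay_shift_2: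
  assumes "b \<le> a"
  shows "macaulay_shift ((a choose 2) + b) 2 = (Suc a choose 3) + (Suc b choose 2)"
proof (cases "b = a")
  case True
  have "macaulay_shift ((Suc a choose 2) + 0) 2 = (Suc (Suc a) choose 3) + (Suc 0 choose 2)"
    by (rule macaulay_shift_2_less) simp
  then show ?thesis
    using True by (simp add: Suc_choose_2 Suc_choose_3[of "Suc a"] binomial_eq_0_iff)
next
  case False
  with assms show ?thesis by (simp add: macaulay_shift_2_less)
qed

lemma macaulay_shift_2_0 [simp]: "macaulay_shift 0 2 = 0"
  by (simp add: macaulay_shift_def)

lemma macaulay_shift_2_Suc: "macaulay_shift n 2 + 1 \<le> macaulay_shift (Suc n) 2"
proof -
  obtain a b where ab: "n = (a choose 2) + b" "b < a" by (rule choose_2_plus_exists)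
  show ?thesis
    using macaulay_shift_2[of b a] macaulay_shift_2[of "Suc b" a] ab by (simp add: Suc_choose_2)
qed

lemma macaulay_shift_2_diff_mono:
  "m \<le> n \<Longrightarrow> macaulay_shift m 2 + (n - m) \<le> macaulay_shift n 2"
proof (induction n rule: dec_induct)
  case (step n)
  with macaulay_shift_2_Suc[of n] show ?case by simp
qed simp

lemma triangle_plus: "(c + d choose 2) = (c choose 2) + (d choose 2) + c * (d::nat)"
  by (induction c) (simp_all add: Suc_choose_2)

text \<open>The increments of \<open>macaulay_shift _ 2\<close> form the sequence \<open>1; 1, 2; 1, 2, 3; \<dots>\<close>, so as
  soon as the block of length \<open>d\<close> has started, any \<open>d\<close> consecutive increments contain the sum
  \<open>1 + \<dots> + d\<close>.\<close>

lemma macaulay_shift_2_step: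
  assumes "(Suc d choose 2) \<le> n"
  shows "macaulay_shift (n - d) 2 + (Suc d choose 2) \<le> macaulay_shift n 2"
proof -
  obtain a b where ab: "n = (a choose 2) + b" "b < a" by (rule choose_2_plus_exists)
  have n: "macaulay_shift n 2 = (Suc a choose 3) + (Suc b choose 2)"
    using macaulay_shift_2[of b a] ab by simp
  have "d < a"
  proof (rule ccontr)
    assume "\<not> d < a"
    then have "(Suc a choose 2) \<le> (Suc d choose 2)" by (intro binomial_right_mono) auto
    with assms ab show False by (simp add: Suc_choose_2)
  qed
  show ?thesis
  proof (cases "d \<le> b")
    case True
    then obtain c where c: "b = c + d" by (metis add.commute le_iff_add)
    have "macaulay_shift (n - d) 2 = (Suc a choose 3) + (Suc c choose 2)"
      using macaulay_shift_2[of c a] ab c by simp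
    then show ?thesis
      unfolding n c using triangle_plus[of "Suc c" d] by (simp add: Suc_choose_2)
  next
    case False
    obtain c where c: "a = Suc c + d"
      using \<open>d < a\<close> by (metis add.commute less_iff_Suc_add add_Suc_right)
    obtain f where f: "d = b + f"
      using False by (metis le_iff_add nat_le_linear)
    \<comment> \<open>Going back \<open>d\<close> steps from an offset \<open>b < d\<close> leaves
      block \<open>a\<close> and ends in the preceding block \<open>c + d\<close>, at offset
      \<open>c + b\<close>.\<close>
    have "n - d = ((c + d) choose 2) + (c + b)"
      using ab c f by (simp add: Suc_choose_2)
    then have "macaulay_shift (n - d) 2 = (Suc (c + d) choose 3) + (Suc (c + b) choose 2)"
      using macaulay_shift_2[of "c + b" "c + d"] False by simp
    then show ?thesis
      unfolding n c
      using triangle_plus[of c "Suc d"] triangle_plus[of c "Suc b"] False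
      by (simp add: Suc_choose_3[of "Suc (c + (b + f))"] f add_mult_distrib2)
  qed
qed

text \<open>The last increments leading to \<open>t\<close> are \<open>1, ..., Suc b\<close>. The
  last \<open>Suc b\<close> increments leading to \<open>s + t\<close> contribute at least the same
  sum, and induction handles what remains.\<close>

lemma macaulay_shift_2_superadditive:
  "macaulay_shift s 2 + macaulay_shift t 2 \<le> macaulay_shift (s + t) 2"
proof (induction t rule: less_induct)
  case (less t)
  show ?case
  proof (cases "t = 0")
    case False
    \<comment> \<open>Decomposing \<open>t - 1\<close> instead of \<open>t\<close> makes the final
      partial block, of length \<open>Suc b\<close>, nonempty.\<close>
    obtain c b where cb: "t - 1 = (c choose 2) + b" "b < c" by (rule choose_2_plus_exists)
    with False have t: "t = (c choose 2) + Suc b" by linarith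
    have ft: "macaulay_shift t 2 = macaulay_shift (t - Suc b) 2 + (Suc (Suc b) choose 2)"
      using macaulay_shift_2[of "Suc b" c] macaulay_shift_2[of 0 c] t cb(2) by (simp add: binomial_eq_0_iff)
    have "(Suc b choose 2) \<le> (c choose 2)" using cb(2) by (intro binomial_right_mono) auto
    then have "(Suc (Suc b) choose 2) \<le> s + t"
      using t by (simp add: Suc_choose_2)
    from macaulay_shift_2_step[OF this]
    have "macaulay_shift (s + (t - Suc b)) 2 + (Suc (Suc b) choose 2) \<le> macaulay_shift (s + t) 2"
      using t by simp
    moreover have "macaulay_shift s 2 + macaulay_shift (t - Suc b) 2 \<le> macaulay_shift (s + (t - Suc b)) 2"
      using less.IH[of "t - Suc b"] False by simp
    ultimately show ?thesis using ft by simp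
  qed simp
qed

subsection \<open>Growth of order ideals of monomials\<close>

text \<open>Multisets stand for monomials. This is the largest degree \<open>Suc k\<close> part that
  an order ideal with degree \<open>k\<close> part \<open>Q\<close> can have.\<close>

definition upper_shadow :: "'a multiset set \<Rightarrow> nat \<Rightarrow> 'a multiset set" where
  "upper_shadow Q k = {u. size u = Suc k \<and> (\<forall>x\<in>#u. u - {#x#} \<in> Q)}"

lemma finite_upper_shadow:
  assumes "finite Q" "k \<ge> 1"
  shows "finite (upper_shadow Q k)"
proof (rule finite_subset)
  show "upper_shadow Q k \<subseteq> (\<lambda>(x, q). add_mset x q) ` ((\<Union>q\<in>Q. set_mset q) \<times> Q)"
  proof
    fix u assume u: "u \<in> upper_shadow Q k"
    then obtain x v where xv: "u = add_mset x v"
      unfolding upper_shadow_def by (metis (mono_tags, lifting) mem_Collect_eq size_eq_Suc_imp_eq_union)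
    \<comment> \<open>Since \<open>k \<ge> 1\<close>, some \<open>y\<close> can be removed other
      than the chosen occurrence of \<open>x\<close>; thus \<open>x\<close> occurs in a member of
      \<open>Q\<close>, which leaves finitely many candidates.\<close>
    have "size v = k" using u xv by (simp add: upper_shadow_def)
    then obtain y where y: "y \<in># v" using assms(2) by fastforce
    have "v \<in> Q" using u xv by (force simp: upper_shadow_def)
    moreover have "u - {#y#} \<in> Q" using u xv y by (simp add: upper_shadow_def)
    moreover have "x \<in># u - {#y#}"
      using xv y by (auto dest!: multi_member_split)
    ultimately show "u \<in> (\<lambda>(x, q). add_mset x q) ` ((\<Union>q\<in>Q. set_mset q) \<times> Q)"
      using xv by (auto intro!: image_eqI[of _ _ "(x, v)"])
  qed
  show "finite ((\<lambda>(x, q). add_mset x q) ` ((\<Union>q\<in>Q. set_mset q) \<times> Q))"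
    using assms(1) by auto
qed

lemma upper_shadow_split:
  "upper_shadow Q k \<subseteq> {u \<in> upper_shadow Q k. v \<in># u} \<union> upper_shadow (Q - {q \<in> Q. v \<in># q}) k"
  by (auto simp: upper_shadow_def dest: in_diffD)

text \<open>The stars are added one at a time: a pair containing the new \<open>w\<close> that was
  counted before must be \<open>{#w, x#}\<close> with \<open>x\<close> among the earlier elements,
  so at most \<open>card W\<close> pairs are lost.\<close>

lemma card_stars:
  assumes Q: "finite Q" "\<And>q. q \<in> Q \<Longrightarrow> size q = 2"
    and W: "finite W" "card W \<le> d" "\<And>w. w \<in> W \<Longrightarrow> d \<le> card {q \<in> Q. w \<in># q}"
  shows "(\<Sum>i<card W. d - i) \<le> card {q \<in> Q. \<exists>w\<in>W. w \<in># q}"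
  using W
proof (induction W)
  case empty
  then show ?case by simp
next
  case (insert w W)
  let ?S = "{q \<in> Q. w \<in># q}" and ?R = "{q \<in> Q. \<exists>w\<in>W. w \<in># q}"
  have "?S \<inter> ?R \<subseteq> (\<lambda>x. {#w, x#}) ` W"
  proof
    fix q assume q: "q \<in> ?S \<inter> ?R"
    then obtain x where x: "x \<in> W" "x \<in># q" by blast
    from q obtain p where p: "q = add_mset w p" by (auto dest: multi_member_split)
    with q Q(2)[of q] have "size p = 1" by simp
    then obtain y where y: "p = {#y#}" using size_1_singleton_mset by metis
    show "q \<in> (\<lambda>x. {#w, x#}) ` W" using p y x insert.hyps by auto
  qed
  then have "card (?S \<inter> ?R) \<le> card W"
    by (meson card_image_le card_mono finite_imageI insert.hyps(1) le_trans)
  moreover have "card (?S - ?R) = card ?S - card (?S \<inter> ?R)"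
    using Q(1) by (simp add: card_Diff_subset_Int)
  moreover have "d \<le> card ?S" using insert.prems by simp
  ultimately have "d - card W \<le> card (?S - ?R)" by linarith
  moreover have "(\<Sum>i<card W. d - i) \<le> card ?R" using insert by simp
  moreover have "card {q \<in> Q. \<exists>w'\<in>insert w W. w' \<in># q} = card (?S - ?R) + card ?R"
  proof -
    have "{q \<in> Q. \<exists>w'\<in>insert w W. w' \<in># q} = (?S - ?R) \<union> ?R" by auto
    moreover have "card ((?S - ?R) \<union> ?R) = card (?S - ?R) + card ?R"
      using Q(1) by (intro card_Un_disjoint) auto
    ultimately show ?thesis by simp
  qed
  ultimately show ?case using insert.hyps by simp
qed

lemma sum_descending: "(\<Sum>i<d. d - i) = (Suc d choose 2)"
  by (induction d) (simp_all add: Suc_choose_2 sum.lessThan_Suc_shift del: sum.lessThan_Suc)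

text \<open>View \<open>Q\<close> as a graph with loops and delete a vertex \<open>v\<close> of
  minimal degree \<open>d\<close>. The triples through \<open>v\<close> are given by pairs of
  neighbours, at most \<open>Suc d choose 2\<close> of them, and
  \<open>macaulay_shift_2_step\<close> pays for exactly this number when \<open>d\<close> edges are
  removed.\<close>

lemma card_upper_shadow_2:
  assumes "finite Q" "\<And>q. q \<in> Q \<Longrightarrow> size q = 2"
  shows "card (upper_shadow Q 2) \<le> macaulay_shift (card Q) 2"
  using assms
proof (induction "card Q" arbitrary: Q rule: less_induct)
  case less
  show ?case
  proof (cases "Q = {}")
    case True
    have "upper_shadow ({} :: 'a multiset set) 2 = {}"
      by (auto simp: upper_shadow_def)
    then show ?thesis using True by simp
  next
    case False
    define deg where "deg x = card {q \<in> Q. x \<in># q}" for x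
    define V where "V = (\<Union>q\<in>Q. set_mset q)"
    have "V \<noteq> {}" using False less.prems(2) by (fastforce simp: V_def)
    moreover have "finite V" using less.prems(1) by (simp add: V_def)
    ultimately obtain v where v: "v \<in> V" "\<And>x. x \<in> V \<Longrightarrow> deg v \<le> deg x"
      by (metis arg_min_if_finite(1) arg_min_least)
    define d where "d = deg v"
    define N where "N = {x. {#v, x#} \<in> Q}"
    have Qv: "{q \<in> Q. v \<in># q} = (\<lambda>x. {#v, x#}) ` N"
    proof
      show "{q \<in> Q. v \<in># q} \<subseteq> (\<lambda>x. {#v, x#}) ` N"
      proof
        fix q assume q: "q \<in> {q \<in> Q. v \<in># q}"
        then obtain p where p: "q = add_mset v p" by (auto dest: multi_member_split)
        with q less.prems(2)[of q] have "size p = 1" by simp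
        then obtain y where y: "p = {#y#}" using size_1_singleton_mset by metis
        show "q \<in> (\<lambda>x. {#v, x#}) ` N" using p y q by (auto simp: N_def)
      qed
    qed (auto simp: N_def)
    have inj: "inj_on (\<lambda>x. {#v, x#}) N" by (auto simp: inj_on_def)
    have cN: "card N = d" unfolding d_def deg_def Qv by (simp add: card_image inj)
    have fN: "finite N"
    proof (rule finite_imageD[OF _ inj])
      have "finite {q \<in> Q. v \<in># q}" using less.prems(1) by simp
      then show "finite ((\<lambda>x. {#v, x#}) ` N)" by (simp only: Qv)
    qed
    have "N \<subseteq> V"
    proof
      fix x assume "x \<in> N"
      then have "{#v, x#} \<in> Q" by (simp add: N_def)
      moreover have "x \<in># {#v, x#}" by simp
      ultimately show "x \<in> V" unfolding V_def by (rule UN_I)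
    qed
    \<comment> \<open>All \<open>d\<close> neighbours of \<open>v\<close> have degree at least
      \<open>d\<close>, which makes \<open>Q\<close> large enough for
      \<open>macaulay_shift_2_step\<close>.\<close>
    have "(\<Sum>i<card N. d - i) \<le> card {q \<in> Q. \<exists>w\<in>N. w \<in># q}"
      using v(2) \<open>N \<subseteq> V\<close> cN fN less.prems
      by (intro card_stars) (auto simp: d_def deg_def)
    also have "\<dots> \<le> card Q" using less.prems(1) by (intro card_mono) auto
    finally have big: "(Suc d choose 2) \<le> card Q" by (simp add: cN sum_descending)
    have "{u \<in> upper_shadow Q 2. v \<in># u} \<subseteq> add_mset v ` multisets_of_size N 2"
    proof
      fix u assume u: "u \<in> {u \<in> upper_shadow Q 2. v \<in># u}"
      then obtain p where p: "u = add_mset v p" by (auto dest: multi_member_split)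
      have sp: "size p = 2" using u p by (simp add: upper_shadow_def)
      have "set_mset p \<subseteq> N"
      proof
        fix x assume x: "x \<in># p"
        then obtain r where r: "p = add_mset x r" by (auto dest: multi_member_split)
        then have "size r = 1" using sp by simp
        then obtain y where y: "r = {#y#}" using size_1_singleton_mset by metis
        have "u - {#y#} \<in> Q" using u p r y by (simp add: upper_shadow_def)
        then show "x \<in> N" using p r y by (simp add: N_def)
      qed
      then show "u \<in> add_mset v ` multisets_of_size N 2"
        using p sp by (auto simp: multisets_of_size_def)
    qed
    then have "card {u \<in> upper_shadow Q 2. v \<in># u} \<le> card (add_mset v ` multisets_of_size N 2)"
      using fN by (intro card_mono) (auto intro: finite_multisets_of_size)
    also have "\<dots> \<le> card (multisets_of_size N 2)"
      using fN by (intro card_image_le) (auto intro: finite_multisets_of_size)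
    also have "\<dots> = (Suc d choose 2)" using fN cN by (simp add: card_multisets_of_size)
    finally have A: "card {u \<in> upper_shadow Q 2. v \<in># u} \<le> (Suc d choose 2)" .
    let ?Q = "Q - {q \<in> Q. v \<in># q}"
    have "card {q \<in> Q. v \<in># q} = d" by (simp add: d_def deg_def)
    then have cQ: "card ?Q = card Q - d" using less.prems(1) by (subst card_Diff_subset) auto
    have "d > 0" using v(1) less.prems(1) by (auto simp: d_def deg_def V_def card_gt_0_iff)
    then have "card ?Q < card Q" using cQ False less.prems(1) by (simp add: card_gt_0_iff)
    then have "card (upper_shadow ?Q 2) \<le> macaulay_shift (card Q - d) 2"
      using less.hyps[of ?Q] less.prems cQ by simp
    moreover have "card (upper_shadow Q 2) \<le>
        card ({u \<in> upper_shadow Q 2. v \<in># u} \<union> upper_shadow ?Q 2)"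
      using less.prems(1)
      by (intro card_mono upper_shadow_split) (simp_all add: finite_upper_shadow)
    moreover have "\<dots> \<le> card {u \<in> upper_shadow Q 2. v \<in># u} + card (upper_shadow ?Q 2)"
      by (rule card_Un_le)
    ultimately show ?thesis using A macaulay_shift_2_step[OF big] by linarith
  qed
qed

text \<open>The shift in degree two serves as a bound in every degree \<open>k\<close>, because
  superadditivity permits splitting \<open>Q\<close> by whether a fixed \<open>v\<close> occurs. The
  part with \<open>v\<close> drops to degree \<open>k - 1\<close>, the part without \<open>v\<close>
  is smaller.\<close>

lemma card_upper_shadow:
  assumes "finite Q" "\<And>q. q \<in> Q \<Longrightarrow> size q = k" "k \<ge> 2"
  shows "card (upper_shadow Q k) \<le> macaulay_shift (card Q) 2"
  using assms(3,1,2)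
proof (induction k arbitrary: Q rule: nat_induct_at_least)
  case base
  then show ?case by (intro card_upper_shadow_2) auto
next
  case (Suc k)
  note IHk = Suc.IH
  have "k \<ge> 2" by (fact Suc.hyps)
  from Suc.prems show ?case
  proof (induction "card Q" arbitrary: Q rule: less_induct)
    case less
    show ?case
    proof (cases "Q = {}")
      case True
      have "upper_shadow ({} :: 'a multiset set) (Suc k) = {}"
        by (auto simp: upper_shadow_def)
      then show ?thesis using True by simp
    next
      case False
      then obtain q v where q: "q \<in> Q" "v \<in># q"
        using less.prems(2) by (metis all_not_in_conv multiset_nonemptyE nat.distinct(1) size_empty)
      define Qv where "Qv = {q \<in> Q. v \<in># q}"
      \<comment> \<open>\<open>L\<close> is the link of \<open>v\<close>: removing one
        \<open>v\<close> is injective on \<open>Qv\<close>, so passing to degree \<open>k\<close>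
        loses no elements.\<close>
      define L where "L = (\<lambda>q. q - {#v#}) ` Qv"
      have fin: "finite Qv" "finite L" using less.prems(1) by (auto simp: Qv_def L_def)
      have cL: "card L = card Qv"
        unfolding L_def by (rule card_image) (auto simp: inj_on_def Qv_def dest!: multi_member_split)
      have sub: "{u \<in> upper_shadow Q (Suc k). v \<in># u} \<subseteq> add_mset v ` upper_shadow L k"
      proof
        fix u assume u: "u \<in> {u \<in> upper_shadow Q (Suc k). v \<in># u}"
        then obtain p where p: "u = add_mset v p" by (auto dest: multi_member_split)
        have "p - {#x#} \<in> L" if x: "x \<in># p" for x
        proof -
          have "u - {#x#} = add_mset v (p - {#x#})" using p x by simp
          moreover have "u - {#x#} \<in> Q" using u p x by (simp add: upper_shadow_def)
          ultimately show ?thesis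
            unfolding L_def Qv_def by (intro image_eqI[of _ _ "u - {#x#}"]) auto
        qed
        then show "u \<in> add_mset v ` upper_shadow L k"
          using u p by (auto simp: upper_shadow_def)
      qed
      have sL: "size q = k" if "q \<in> L" for q
        using that less.prems(2) by (auto simp: L_def Qv_def size_Diff_singleton)
      have "card {u \<in> upper_shadow Q (Suc k). v \<in># u} \<le> card (add_mset v ` upper_shadow L k)"
        using fin sub \<open>k \<ge> 2\<close> by (intro card_mono finite_imageI finite_upper_shadow) auto
      also have "\<dots> \<le> card (upper_shadow L k)"
        using fin \<open>k \<ge> 2\<close> by (intro card_image_le finite_upper_shadow) auto
      also have "\<dots> \<le> macaulay_shift (card Qv) 2"
        using IHk[OF fin(2) sL] by (simp add: cL)
      finally have A: "card {u \<in> upper_shadow Q (Suc k). v \<in># u} \<le> macaulay_shift (card Qv) 2" .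
      have cQ: "card (Q - Qv) + card Qv = card Q"
        using less.prems(1) fin by (simp add: Qv_def card_Diff_subset card_mono)
      moreover have "card Qv > 0" using fin q by (auto simp: card_gt_0_iff Qv_def)
      ultimately have "card (Q - Qv) < card Q" by linarith
      then have "card (upper_shadow (Q - Qv) (Suc k)) \<le> macaulay_shift (card (Q - Qv)) 2"
        using less.hyps[of "Q - Qv"] less.prems by simp
      moreover have "card (upper_shadow Q (Suc k)) \<le>
          card ({u \<in> upper_shadow Q (Suc k). v \<in># u} \<union> upper_shadow (Q - Qv) (Suc k))"
        using less.prems(1) unfolding Qv_def
        by (intro card_mono upper_shadow_split) (simp_all add: finite_upper_shadow)
      moreover have "\<dots> \<le> card {u \<in> upper_shadow Q (Suc k). v \<in># u} + card (upper_shadow (Q - Qv) (Suc k))"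
        by (rule card_Un_le)
      ultimately show ?thesis
        using A macaulay_shift_2_superadditive[of "card (Q - Qv)" "card Qv"] cQ by simp
    qed
  qed
qed

text \<open>All predecessors of a given \<open>u\<close> have the same degree, so the count splits
  over the degrees occurring in \<open>P\<close>, and superadditivity adds up the bounds.\<close>

lemma card_upper_shadow_mixed:
  assumes "finite P" "\<And>p. p \<in> P \<Longrightarrow> size p \<ge> 2"
  shows "finite {u. size u \<ge> 3 \<and> (\<forall>x\<in>#u. u - {#x#} \<in> P)} \<and>
    card {u. size u \<ge> 3 \<and> (\<forall>x\<in>#u. u - {#x#} \<in> P)} \<le> macaulay_shift (card P) 2"
  using assms
proof (induction "card P" arbitrary: P rule: less_induct)
  case less
  let ?U = "\<lambda>P. {u. size u \<ge> 3 \<and> (\<forall>x\<in>#u. u - {#x#} \<in> P)}"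
  show ?case
  proof (cases "P = {}")
    case True
    have "?U ({} :: 'a multiset set) = {}"
      by auto
    then show ?thesis using True by simp
  next
    case False
    then obtain q where q: "q \<in> P" by blast
    define k where "k = size q"
    define Q where "Q = {p \<in> P. size p = k}"
    have k: "k \<ge> 2" using less.prems(2) q by (simp add: k_def)
    have fin: "finite Q" "finite (P - Q)" using less.prems(1) by (auto simp: Q_def)
    have split: "?U P \<subseteq> upper_shadow Q k \<union> ?U (P - Q)"
      by (auto simp: upper_shadow_def Q_def size_Diff_singleton)
    have cP: "card (P - Q) + card Q = card P"
      using less.prems(1) fin by (simp add: Q_def card_Diff_subset card_mono)
    moreover have "card Q > 0" using fin q by (auto simp: card_gt_0_iff Q_def k_def)
    ultimately have "card (P - Q) < card P" by linarith
    then have IH: "finite (?U (P - Q))" "card (?U (P - Q)) \<le> macaulay_shift (card (P - Q)) 2"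
      using less.hyps[of "P - Q"] less.prems by simp_all
    have fS: "finite (upper_shadow Q k)" using fin k by (intro finite_upper_shadow) auto
    have "card (?U P) \<le> card (upper_shadow Q k) + card (?U (P - Q))"
      using split fS IH(1) card_Un_le card_mono finite_UnI le_trans by meson
    moreover have "card (upper_shadow Q k) \<le> macaulay_shift (card Q) 2"
      using fin k by (intro card_upper_shadow) (auto simp: Q_def)
    ultimately show ?thesis
      using IH split fS macaulay_shift_2_superadditive[of "card (P - Q)" "card Q"] cP
      by (auto intro: finite_subset)
  qed
qed

subsection \<open>Spanning trees and forests\<close>

text \<open>Connectedness in a multigraph. Edges are indexed by \<open>S\<close>, with end points
  given by \<open>p\<close> and \<open>q\<close>, so that parallel edges and loops remain
  distinct.\<close>

definition conn :: "'s set \<Rightarrow> ('s \<Rightarrow> 'v) \<Rightarrow> ('s \<Rightarrow> 'v) \<Rightarrow> ('v \<times> 'v) set" where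
  "conn S p q = ((\<lambda>s. (p s, q s)) ` S \<union> (\<lambda>s. (q s, p s)) ` S)\<^sup>*"

lemma conn_refl [simp]: "(x, x) \<in> conn S p q"
  by (simp add: conn_def)

lemma conn_trans: "(x, y) \<in> conn S p q \<Longrightarrow> (y, z) \<in> conn S p q \<Longrightarrow> (x, z) \<in> conn S p q"
  by (simp add: conn_def)

lemma conn_base: "s \<in> S \<Longrightarrow> (p s, q s) \<in> conn S p q"
  by (auto simp: conn_def)

lemma conn_sym: "(x, y) \<in> conn S p q \<Longrightarrow> (y, x) \<in> conn S p q"
proof -
  have "sym ((\<lambda>s. (p s, q s)) ` S \<union> (\<lambda>s. (q s, p s)) ` S)"
    by (auto simp: sym_def)
  then show "(x, y) \<in> conn S p q \<Longrightarrow> (y, x) \<in> conn S p q"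
    unfolding conn_def by (meson sym_rtrancl symD)
qed

lemma conn_least:
  assumes "(x, y) \<in> conn S p q" "\<And>s. s \<in> S \<Longrightarrow> (p s, q s) \<in> R"
    "\<And>x. (x, x) \<in> R" "\<And>x y. (x, y) \<in> R \<Longrightarrow> (y, x) \<in> R"
    "\<And>x y z. (x, y) \<in> R \<Longrightarrow> (y, z) \<in> R \<Longrightarrow> (x, z) \<in> R"
  shows "(x, y) \<in> R"
  using assms(1) unfolding conn_def
proof (induction rule: rtrancl_induct)
  case base
  then show ?case by (rule assms(3))
next
  case (step y z)
  then have "(y, z) \<in> R" using assms(2,4) by auto
  with step.IH show ?case by (rule assms(5))
qed

text \<open>The hypothesis says that no edge lies on a cycle. Contracting one edge \<open>s\<close>
  by \<open>f\<close> removes a vertex and preserves this property, since a path in the contracted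
  graph lifts to one that may also use \<open>s\<close>.\<close>

lemma card_forest:
  assumes "finite V" "V \<noteq> {}" "p ` S \<subseteq> V" "q ` S \<subseteq> V"
    "\<And>s. s \<in> S \<Longrightarrow> (p s, q s) \<notin> conn (S - {s}) p q"
  shows "finite S \<and> card S < card V"
  using assms
proof (induction "card V" arbitrary: V S p q rule: less_induct)
  case less
  show ?case
  proof (cases "S = {}")
    case True
    then show ?thesis using less.prems(1,2) by (simp add: card_gt_0_iff)
  next
    case False
    then obtain s where s: "s \<in> S" by blast
    have ne: "p s \<noteq> q s" using less.prems(5)[OF s] by (metis conn_refl)
    define f where "f x = (if x = q s then p s else x)" for x
    have mem: "p s \<in> V" "q s \<in> V" using less.prems(3,4) s by auto
    have sm: "card (V - {q s}) < card V"
      using less.prems(1) mem by (meson card_Diff1_less)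
    have "finite (S - {s}) \<and> card (S - {s}) < card (V - {q s})"
    proof (rule less.hyps[OF sm, of "f \<circ> p" _ "f \<circ> q"])
      show "finite (V - {q s})" "V - {q s} \<noteq> {}" using less.prems(1) mem ne by auto
      show "(f \<circ> p) ` (S - {s}) \<subseteq> V - {q s}" "(f \<circ> q) ` (S - {s}) \<subseteq> V - {q s}"
        using less.prems(3,4) mem ne by (auto simp: f_def)
    next
      fix t assume t: "t \<in> S - {s}"
      show "((f \<circ> p) t, (f \<circ> q) t) \<notin> conn (S - {s} - {t}) (f \<circ> p) (f \<circ> q)"
      proof
        assume A: "((f \<circ> p) t, (f \<circ> q) t) \<in> conn (S - {s} - {t}) (f \<circ> p) (f \<circ> q)"
        let ?R = "conn (S - {t}) p q"
        have "(p s, q s) \<in> ?R" using s t by (intro conn_base) auto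
        then have f: "(x, f x) \<in> ?R" "(f x, x) \<in> ?R" for x
          by (auto simp: f_def intro: conn_sym)
        have "((f \<circ> p) t, (f \<circ> q) t) \<in> ?R"
          using A
        proof (rule conn_least)
          fix t' assume "t' \<in> S - {s} - {t}"
          then have "(p t', q t') \<in> ?R" by (intro conn_base) auto
          then show "((f \<circ> p) t', (f \<circ> q) t') \<in> ?R"
            using f by (metis comp_apply conn_trans)
        qed (auto intro: conn_sym conn_trans)
        then have "(p t, q t) \<in> ?R" using f by (metis comp_apply conn_trans)
        then show False using less.prems(5) t by blast
      qed
    qed
    moreover have "card (V - {q s}) = card V - 1" using mem less.prems(1) by simp
    ultimately show ?thesis
      using s by (auto simp: card_Diff_singleton_if)
  qed
qed

text \<open>Contracting an edge keeps the graph connected and merges at most two vertices.\<close>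

lemma card_connected:
  assumes "finite S" "finite V" "\<And>x y. x \<in> V \<Longrightarrow> y \<in> V \<Longrightarrow> (x, y) \<in> conn S p q"
  shows "card V \<le> card S + 1"
  using assms
proof (induction S arbitrary: V p q rule: finite_induct)
  case empty
  have "x = y" if "x \<in> V" "y \<in> V" for x y
    using empty.prems(2)[OF that] by (simp add: conn_def)
  then show ?case by (metis One_nat_def add_0 card.empty card_le_Suc0_iff_eq empty.prems(1))
next
  case (insert s S)
  define f where "f x = (if x = q s then p s else x)" for x
  let ?R = "conn S (f \<circ> p) (f \<circ> q)"
  have "card (f ` V) \<le> card S + 1"
  proof (rule insert.IH)
    show "finite (f ` V)" using insert.prems by simp
    fix x y assume "x \<in> f ` V" "y \<in> f ` V"
    then obtain x' y' where xy: "x = f x'" "y = f y'" "x' \<in> V" "y' \<in> V" by blast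
    have "(x', y') \<in> {(x, y). (f x, f y) \<in> ?R}"
      using insert.prems(2)[OF xy(3,4)]
    proof (rule conn_least)
      fix t assume t: "t \<in> insert s S"
      show "(p t, q t) \<in> {(x, y). (f x, f y) \<in> ?R}"
      proof (cases "t = s")
        case True
        then show ?thesis by (simp add: f_def)
      next
        case False
        then show ?thesis using t conn_base[of t S "f \<circ> p" "f \<circ> q"] by simp
      qed
    qed (auto intro: conn_sym conn_trans)
    then show "(x, y) \<in> ?R" using xy by simp
  qed
  moreover have "V \<subseteq> insert (q s) (f ` V)" by (force simp: f_def)
  then have "card V \<le> card (insert (q s) (f ` V))"
    using insert.prems(1) by (intro card_mono) auto
  then have "card V \<le> Suc (card (f ` V))"
    using card_insert_le_m1[of "Suc (card (f ` V))" "f ` V" "q s"] by simp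
  ultimately show ?case using insert.hyps by simp
qed

subsection \<open>Minimal generating sets of the kernel congruence\<close>

lemma tuples_0 [simp]: "0 \<in> tuples n"
  by (simp add: tuples_def)

lemma tuples_add [simp]: "a + b \<in> tuples n \<longleftrightarrow> a \<in> tuples n \<and> b \<in> tuples n"
  by (auto simp: tuples_def)

lemma tuples_supportD: "a \<in> tuples n \<Longrightarrow> a i \<noteq> 0 \<Longrightarrow> i < n"
  by (rule ccontr) (simp add: tuples_def)

lemma tuples_finite_support: "a \<in> tuples n \<Longrightarrow> finite {i. a i > 0}"
  by (rule finite_subset[of _ "{..<n}"]) (auto dest: tuples_supportD)

lemma tuples_count_iff: "count M \<in> tuples n \<longleftrightarrow> set_mset M \<subseteq> {..<n}"
proof
  assume M: "count M \<in> tuples n"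
  show "set_mset M \<subseteq> {..<n}" using tuples_supportD[OF M] by auto
qed (auto simp: tuples_def count_eq_zero_iff)

lemma count_plus: "count (M + N) = count M + count N"
  by (simp add: fun_eq_iff)

lemma tuples_multiset:
  assumes "a \<in> tuples n"
  obtains M where "a = count M" "set_mset M \<subseteq> {..<n}"
proof
  show "a = count (Abs_multiset a)"
    using tuples_finite_support[OF assms] by (simp add: Abs_multiset_inverse)
  then show "set_mset (Abs_multiset a) \<subseteq> {..<n}"
    using assms tuples_count_iff by metis
qed

lemma congruence_refl: "tuple_congruence n R \<Longrightarrow> a \<in> tuples n \<Longrightarrow> (a, a) \<in> R"
  by (auto simp: tuple_congruence_def equiv_def refl_on_def)

lemma congruence_sym: "tuple_congruence n R \<Longrightarrow> (a, b) \<in> R \<Longrightarrow> (b, a) \<in> R"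
  by (auto simp: tuple_congruence_def equiv_def sym_def)

lemma congruence_trans: "tuple_congruence n R \<Longrightarrow> (a, b) \<in> R \<Longrightarrow> (b, c) \<in> R \<Longrightarrow> (a, c) \<in> R"
  unfolding tuple_congruence_def equiv_def by (meson transD)

lemma congruence_add:
  "tuple_congruence n R \<Longrightarrow> (a, b) \<in> R \<Longrightarrow> (c, d) \<in> R \<Longrightarrow> (a + c, b + d) \<in> R"
  by (simp add: tuple_congruence_def plus_fun_def)

lemma congruence_subset: "tuple_congruence n R \<Longrightarrow> R \<subseteq> tuples n \<times> tuples n"
  by (auto simp: tuple_congruence_def equiv_def)

lemma tuple_congruenceI:
  assumes "R \<subseteq> tuples n \<times> tuples n" "\<And>a. a \<in> tuples n \<Longrightarrow> (a, a) \<in> R"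
    "\<And>a b. (a, b) \<in> R \<Longrightarrow> (b, a) \<in> R"
    "\<And>a b c. (a, b) \<in> R \<Longrightarrow> (b, c) \<in> R \<Longrightarrow> (a, c) \<in> R"
    "\<And>a b c d. (a, b) \<in> R \<Longrightarrow> (c, d) \<in> R \<Longrightarrow> (a + c, b + d) \<in> R"
  shows "tuple_congruence n R"
  unfolding tuple_congruence_def equiv_def
proof (intro conjI allI impI)
  show "trans R" using assms(4) by (rule transI)
  fix a b c d assume "(a, b) \<in> R" "(c, d) \<in> R"
  then show "(\<lambda>i. a i + c i, \<lambda>i. b i + d i) \<in> R"
    using assms(5) by (simp add: plus_fun_def)
qed (use assms(1-3) in \<open>auto simp: refl_on_def sym_def\<close>)

text \<open>The congruence \<open>X\<close> makes the family being intersected nonempty; an empty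
  intersection would be everything and not a relation on tuples.\<close>

lemma congruence_hull:
  assumes "S \<subseteq> X" "tuple_congruence n X"
  shows "tuple_congruence n (tuple_congruence n hull S)"
proof (rule tuple_congruenceI)
  show "tuple_congruence n hull S \<subseteq> tuples n \<times> tuples n"
    using hull_minimal[of S X "tuple_congruence n", OF assms] congruence_subset[OF assms(2)] by (rule subset_trans)
qed (auto simp: hull_def intro: congruence_refl congruence_sym congruence_trans congruence_add)

text \<open>Arbitrary positive weights are allowed, so that the same results serve the generators of
  a given monoid and a constructed sequence not yet known to consist of minimal generators.\<close>

locale graded =
  fixes n :: nat and g :: "nat \<Rightarrow> nat"
  assumes g_pos: "i < n \<Longrightarrow> g i > 0"
begin

definition weight :: "(nat \<Rightarrow> nat) \<Rightarrow> nat" where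
  "weight a = (\<Sum>i<n. a i * g i)"

definition ker :: "((nat \<Rightarrow> nat) \<times> (nat \<Rightarrow> nat)) set" where
  "ker = {(a, b) \<in> tuples n \<times> tuples n. weight a = weight b}"

lemma weight_0 [simp]: "weight 0 = 0"
  by (simp add: weight_def)

lemma weight_add [simp]: "weight (a + b) = weight a + weight b"
  by (simp add: weight_def sum.distrib add_mult_distrib)

lemma weight_count_single: "i < n \<Longrightarrow> weight (count {#i#}) = g i"
  by (simp add: weight_def if_distrib[of "\<lambda>x. x * _"] cong: if_cong)

lemma weight_add_mset: "i < n \<Longrightarrow> weight (count (add_mset i M)) = g i + weight (count M)"
  using weight_add[of "count {#i#}" "count M"] weight_count_single[of i]
  by (simp add: count_plus[symmetric] del: weight_add)

lemma weight_replicate: "i < n \<Longrightarrow> weight (count (replicate_mset k i)) = k * g i"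
  by (simp add: weight_def if_distrib[of "\<lambda>x. x * _"] cong: if_cong)

lemma weight_eq_0_iff: "a \<in> tuples n \<Longrightarrow> weight a = 0 \<longleftrightarrow> a = 0"
proof
  assume a: "a \<in> tuples n" and w: "weight a = 0"
  show "a = 0"
  proof
    fix i
    show "a i = 0 i"
      using a w g_pos[of i] tuples_supportD[OF a, of i] by (fastforce simp: weight_def)
  qed
qed simp

lemma le_weight: "i < n \<Longrightarrow> a i \<le> weight a"
proof -
  assume i: "i < n"
  have "a i \<le> a i * g i" using g_pos[OF i] by simp
  also have "\<dots> \<le> weight a"
    unfolding weight_def using i by (intro member_le_sum) auto
  finally show ?thesis .
qed

lemma finite_fibre: "finite {a \<in> tuples n. weight a = b}"
proof (rule finite_subset)
  show "{a \<in> tuples n. weight a = b} \<subseteq>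
      {a. \<forall>i. (i \<in> {..<n} \<longrightarrow> a i \<in> {..b}) \<and> (i \<notin> {..<n} \<longrightarrow> a i = 0)}"
    using le_weight by (auto simp: tuples_def)
  show "finite {a. \<forall>i. (i \<in> {..<n} \<longrightarrow> a i \<in> {..b}) \<and> (i \<notin> {..<n} \<longrightarrow> a i = (0::nat))}"
    by (rule finite_set_of_finite_funs) auto
qed

lemma congruence_ker: "tuple_congruence n ker"
  by (rule tuple_congruenceI) (auto simp: ker_def)

section \<open>Normal forms and rewriting in the fibres of the weight\<close>

definition normal :: "(nat \<Rightarrow> nat) \<Rightarrow> bool" where
  "normal a \<longleftrightarrow> a \<in> tuples n \<and> (\<forall>b\<in>tuples n. weight b = weight a \<longrightarrow> \<not> less_fun a b)"

text \<open>These are the minimal generators of the monomial ideal of non-normal tuples, the initial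
  ideal in the language of Groebner bases.\<close>

definition min_nonnormal :: "(nat \<Rightarrow> nat) set" where
  "min_nonnormal = {u \<in> tuples n. \<not> normal u \<and> (\<forall>c d. u = c + d \<longrightarrow> d \<noteq> 0 \<longrightarrow> normal c)}"

definition nf :: "(nat \<Rightarrow> nat) \<Rightarrow> (nat \<Rightarrow> nat)" where
  "nf a = (SOME b. normal b \<and> weight b = weight a)"

text \<open>This is the termination measure: fibres are finite, and each rewriting step moves to a
  lexicographically larger tuple.\<close>

definition rank :: "(nat \<Rightarrow> nat) \<Rightarrow> nat" where
  "rank a = card {b \<in> tuples n. weight b = weight a \<and> less_fun a b}"

lemma rank_less:
  assumes "a \<in> tuples n" "b \<in> tuples n" "weight b = weight a" "less_fun a b"
  shows "rank b < rank a"
  unfolding rank_def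
proof (rule psubset_card_mono)
  show "finite {c \<in> tuples n. weight c = weight a \<and> less_fun a c}"
    by (rule finite_subset[OF _ finite_fibre[of "weight a"]]) auto
  show "{c \<in> tuples n. weight c = weight b \<and> less_fun b c} \<subset> {c \<in> tuples n. weight c = weight a \<and> less_fun a c}"
    using assms less_fun_trans less_fun_irrefl[of b] by (auto simp: psubset_eq)
qed

lemma normal_exists: "a \<in> tuples n \<Longrightarrow> \<exists>b. normal b \<and> weight b = weight a"
proof (induction "rank a" arbitrary: a rule: less_induct)
  case less
  show ?case
  proof (cases "normal a")
    case False
    then obtain b where b: "b \<in> tuples n" "weight b = weight a" "less_fun a b"
      using less.prems by (auto simp: normal_def)
    then show ?thesis using less.hyps[of b] rank_less[OF less.prems b] by auto
  qed blast
qed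

lemma nf:
  assumes "a \<in> tuples n"
  shows "normal (nf a)" "weight (nf a) = weight a" "nf a \<in> tuples n"
proof -
  have "normal (nf a) \<and> weight (nf a) = weight a"
    unfolding nf_def using someI_ex[OF normal_exists[OF assms]] .
  then show "normal (nf a)" "weight (nf a) = weight a" "nf a \<in> tuples n"
    by (auto simp: normal_def)
qed

lemma tuples_trichotomy:
  assumes "a \<in> tuples n" "b \<in> tuples n"
  shows "less_fun a b \<or> a = b \<or> less_fun b a"
proof (rule less_fun_trichotomy)
  have "{k. a k \<noteq> b k} \<subseteq> {..<n}"
    using tuples_supportD[OF assms(1)] tuples_supportD[OF assms(2)]
    by (metis (mono_tags, lifting) lessThan_iff mem_Collect_eq subsetI)
  then show "finite {k. a k \<noteq> b k}" by (rule finite_subset) simp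
qed

lemma normal_unique: "normal a \<Longrightarrow> normal b \<Longrightarrow> weight a = weight b \<Longrightarrow> a = b"
  using tuples_trichotomy[of a b] by (auto simp: normal_def)

lemma less_fun_add: "less_fun a b \<Longrightarrow> less_fun (a + c) (b + (c :: nat \<Rightarrow> nat))"
  by (auto simp: less_fun_def)

text \<open>A larger tuple in the fibre of \<open>a\<close> would, after adding \<open>c\<close>,
  beat \<open>a + c\<close>. Thus normal tuples form an order ideal.\<close>

lemma normal_addD: "normal (a + c) \<Longrightarrow> normal a"
  unfolding normal_def by (metis less_fun_add tuples_add weight_add)

lemma less_fun_nf: "u \<in> tuples n \<Longrightarrow> \<not> normal u \<Longrightarrow> less_fun u (nf u)"
  using tuples_trichotomy[of u "nf u"] nf[of u] by (auto simp: normal_def)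

lemma min_nonnormal_divisor:
  "a \<in> tuples n \<Longrightarrow> \<not> normal a \<Longrightarrow> \<exists>u\<in>min_nonnormal. \<exists>c. a = u + c"
proof (induction "weight a" arbitrary: a rule: less_induct)
  case less
  show ?case
  proof (cases "a \<in> min_nonnormal")
    case True
    then show ?thesis by (metis add.right_neutral)
  next
    case False
    then obtain c d where cd: "a = c + d" "d \<noteq> 0" "\<not> normal c"
      using less.prems by (auto simp: min_nonnormal_def)
    then have "weight c < weight a" using less.prems weight_eq_0_iff[of d] by simp
    then obtain u c' where "u \<in> min_nonnormal" "c = u + c'"
      using less.hyps[of c] less.prems cd by auto
    then show ?thesis using cd by (metis add.assoc)
  qed
qed

text \<open>A divisor \<open>u\<close> of \<open>a\<close> is replaced by \<open>nf u\<close> as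
  long as the cofactor is nonzero, which forces \<open>weight u < b\<close>. Only relations of
  smaller weight are available, so rewriting may also stop at a minimal non-normal tuple of weight
  exactly \<open>b\<close>.\<close>

lemma reduce:
  assumes K: "tuple_congruence n K"
    and T: "\<And>u. u \<in> min_nonnormal \<Longrightarrow> weight u < b \<Longrightarrow> (u, nf u) \<in> K"
  shows "a \<in> tuples n \<Longrightarrow> weight a = b \<Longrightarrow>
    \<exists>t. (normal t \<or> t \<in> min_nonnormal) \<and> weight t = b \<and> (a, t) \<in> K"
proof (induction "rank a" arbitrary: a rule: less_induct)
  case less
  show ?case
  proof (cases "normal a \<or> a \<in> min_nonnormal")
    case True
    then show ?thesis using less.prems congruence_refl[OF K] by blast
  next
    case False
    then obtain u c where u: "u \<in> min_nonnormal" "a = u + c"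
      using min_nonnormal_divisor less.prems by blast
    have tu: "u \<in> tuples n" "c \<in> tuples n" using u less.prems by auto
    have "c \<noteq> 0" using u False by auto
    then have "weight u < b" using weight_eq_0_iff[OF tu(2)] u less.prems by simp
    then have "(a, nf u + c) \<in> K"
      using T[OF u(1)] congruence_add[OF K] congruence_refl[OF K tu(2)] u(2) by blast
    moreover have "less_fun a (nf u + c)"
      using u less_fun_nf[of u] by (auto simp: min_nonnormal_def intro: less_fun_add)
    then have "rank (nf u + c) < rank a"
      using nf[OF tu(1)] u tu less.prems by (intro rank_less) auto
    then obtain t where "normal t \<or> t \<in> min_nonnormal" "weight t = b" "(nf u + c, t) \<in> K"
      using less.hyps[of "nf u + c"] nf[OF tu(1)] tu u less.prems by auto
    ultimately show ?thesis using congruence_trans[OF K] by blast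
  qed
qed

text \<open>The pairs \<open>(u, nf u)\<close> generate the kernel, and a finite generating set of
  least cardinality is minimal for inclusion. This makes the choice in
  \<open>num_min_relations\<close> meaningful.\<close>

lemma minimal_generating_exists:
  assumes "finite min_nonnormal"
  shows "\<exists>S. minimal_generating (tuple_congruence n) ker S"
proof -
  let ?hull = "\<lambda>S. tuple_congruence n hull S"
  define G where "G = (\<lambda>u. (u, nf u)) ` min_nonnormal"
  have "G \<subseteq> ker" using nf by (auto simp: G_def ker_def min_nonnormal_def)
  note K = congruence_hull[OF this congruence_ker]
  have T: "(u, nf u) \<in> ?hull G" if "u \<in> min_nonnormal" for u
    using that by (auto simp: G_def intro: hull_inc)
  have nf_hull: "(a, nf a) \<in> ?hull G" if a: "a \<in> tuples n" for a
  proof -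
    obtain t where t: "normal t \<or> t \<in> min_nonnormal" "weight t = weight a" "(a, t) \<in> ?hull G"
      using reduce[OF K _ a refl] T by blast
    have tt: "t \<in> tuples n" using t(1) by (auto simp: normal_def min_nonnormal_def)
    have "nf t = nf a" using t(2) by (simp add: nf_def)
    moreover have "normal t \<Longrightarrow> nf t = t" using nf[OF tt] normal_unique by blast
    ultimately show ?thesis
      using t T[of t] congruence_trans[OF K] by metis
  qed
  then have "(a, b) \<in> ?hull G" if "(a, b) \<in> ker" for a b
  proof -
    have ab: "a \<in> tuples n" "b \<in> tuples n" "nf a = nf b" using that by (auto simp: ker_def nf_def)
    have "(a, nf b) \<in> ?hull G" "(nf b, b) \<in> ?hull G"
      using nf_hull[OF ab(1)] congruence_sym[OF K nf_hull[OF ab(2)]] ab(3) by simp_all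
    then show ?thesis by (rule congruence_trans[OF K])
  qed
  then have "ker \<subseteq> ?hull G" by auto
  moreover have "?hull G \<subseteq> ker" using \<open>G \<subseteq> ker\<close> congruence_ker by (rule hull_minimal)
  ultimately have "?hull G = ker" by blast
  moreover have "finite G" using assms by (simp add: G_def)
  ultimately have "finite G \<and> ?hull G = ker" by blast
  then have "\<exists>H. (finite H \<and> ?hull H = ker) \<and> (\<forall>H'. finite H' \<and> ?hull H' = ker \<longrightarrow> card H \<le> card H')"
    by (rule ex_has_least_nat)
  then obtain H where H': "(finite H \<and> ?hull H = ker) \<and> (\<forall>H'. finite H' \<and> ?hull H' = ker \<longrightarrow> card H \<le> card H')" ..
  then have H: "finite H" "?hull H = ker" "\<And>H'. finite H' \<Longrightarrow> ?hull H' = ker \<Longrightarrow> card H \<le> card H'"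
    by simp_all
  have "minimal_generating (tuple_congruence n) ker H"
    unfolding minimal_generating_def
    using H by (meson finite_subset not_le psubset_card_mono psubset_imp_subset)
  then show ?thesis by blast
qed

lemma card_normal_weight: "finite {t. normal t \<and> weight t = b} \<and> card {t. normal t \<and> weight t = b} \<le> 1"
proof -
  have "finite {t. normal t \<and> weight t = b}"
    by (rule finite_subset[OF _ finite_fibre[of b]]) (auto simp: normal_def)
  moreover have "card {t. normal t \<and> weight t = b} \<le> Suc 0"
    using calculation normal_unique by (subst card_le_Suc0_iff_eq) auto
  ultimately show ?thesis by simp
qed

text \<open>In each degree \<open>b\<close>, modulo the relations of smaller degree every element of the fibre is
  equivalent to its normal form or to a minimal non-normal tuple of degree \<open>b\<close>, and the
  relations of degree \<open>b\<close> in a minimal generating set form a forest on these representatives.\<close>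

lemma card_minimal_generating_le:
  assumes fin: "finite min_nonnormal" and S: "minimal_generating (tuple_congruence n) ker S"
  shows "finite S \<and> card S \<le> card min_nonnormal"
proof -
  let ?hull = "\<lambda>S. tuple_congruence n hull S"
  have hS: "?hull S = ker" and min: "\<And>H. H \<subset> S \<Longrightarrow> ?hull H \<noteq> ker"
    using S by (auto simp: minimal_generating_def)
  have Sk: "S \<subseteq> ker" using hull_subset[of S "tuple_congruence n"] hS by simp
  define deg where "deg b = {s \<in> S. weight (fst s) = b}" for b
  define T where "T b = {u \<in> min_nonnormal. weight u = b}" for b
  have main: "finite (deg b) \<and> card (deg b) \<le> card (T b)" for b
  proof (cases "deg b = {}")
    case False
    define Sb where "Sb = {s \<in> S. weight (fst s) < b}"
    define K where "K = ?hull Sb"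
    have "Sb \<subseteq> ker" using Sk by (auto simp: Sb_def)
    then have K: "tuple_congruence n K" unfolding K_def by (rule congruence_hull[OF _ congruence_ker])
    \<comment> \<open>\<open>R\<close> is a congruence because a summand never outweighs the sum,
      and it contains \<open>S\<close>. Hence it is all of \<open>ker\<close>: below weight
      \<open>b\<close>, the generators of smaller weight suffice.\<close>
    define R where "R = {(x, y) \<in> ker. weight x < b \<longrightarrow> (x, y) \<in> K}"
    have "ker \<subseteq> R"
    proof -
      have "tuple_congruence n R"
        unfolding R_def by (rule tuple_congruenceI)
          (auto simp: ker_def intro: congruence_refl[OF K] congruence_sym[OF K]
            congruence_trans[OF K] congruence_add[OF K])
      moreover have "S \<subseteq> R"
        using Sk by (auto simp: R_def K_def Sb_def intro: hull_inc)
      ultimately show ?thesis using hull_minimal[of S R "tuple_congruence n"] hS by simp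
    qed
    then have low: "(u, nf u) \<in> K" if "u \<in> min_nonnormal" "weight u < b" for u
      using that nf[of u] by (auto simp: R_def ker_def min_nonnormal_def)
    define V where "V = T b \<union> {t. normal t \<and> weight t = b}"
    define red where "red x = (SOME t. t \<in> V \<and> (x, t) \<in> K)" for x
    have red: "red x \<in> V" "(x, red x) \<in> K" if "x \<in> tuples n" "weight x = b" for x
    proof -
      have "\<exists>t. t \<in> V \<and> (x, t) \<in> K"
        using reduce[OF K low that] by (auto simp: V_def T_def)
      then have "red x \<in> V \<and> (x, red x) \<in> K" unfolding red_def by (rule someI_ex)
      then show "red x \<in> V" "(x, red x) \<in> K" by auto
    qed
    have sd: "fst s \<in> tuples n" "snd s \<in> tuples n" "weight (fst s) = b" "weight (snd s) = b"
      if "s \<in> deg b" for s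
      using that Sk by (auto simp: deg_def ker_def)
    have fV: "finite V" using fin card_normal_weight by (simp add: V_def T_def)
    have sub: "(red \<circ> fst) ` deg b \<subseteq> V" "(red \<circ> snd) ` deg b \<subseteq> V"
      using red sd by auto
    have "V \<noteq> {}" using False sub by blast
    have "finite (deg b) \<and> card (deg b) < card V"
      using fV \<open>V \<noteq> {}\<close> sub
    proof (rule card_forest)
      fix s assume s: "s \<in> deg b"
      show "((red \<circ> fst) s, (red \<circ> snd) s) \<notin> conn (deg b - {s}) (red \<circ> fst) (red \<circ> snd)"
      proof
        assume A: "((red \<circ> fst) s, (red \<circ> snd) s) \<in> conn (deg b - {s}) (red \<circ> fst) (red \<circ> snd)"
        define L where "L = ?hull (S - {s})"
        have L: "tuple_congruence n L"
          unfolding L_def using Sk by (intro congruence_hull[OF _ congruence_ker]) auto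
        have "K \<subseteq> L" unfolding K_def L_def
          using s by (intro hull_mono) (auto simp: Sb_def deg_def)
        then have rL: "(x, red x) \<in> L" "(red x, x) \<in> L" if "x \<in> tuples n" "weight x = b" for x
          using red[OF that] congruence_sym[OF L] by auto
        \<comment> \<open>\<open>Id\<close> is added because \<open>conn\<close> is reflexive on all
          functions, while \<open>L\<close> is reflexive only on \<open>tuples n\<close>.\<close>
        have "((red \<circ> fst) s, (red \<circ> snd) s) \<in> L \<union> Id"
          using A
        proof (rule conn_least)
          fix t assume t: "t \<in> deg b - {s}"
          then have "(fst t, snd t) \<in> L" by (auto simp: L_def deg_def intro: hull_inc)
          then have "(red (fst t), red (snd t)) \<in> L"
            using rL sd t congruence_trans[OF L] by (meson DiffD1)
          then show "((red \<circ> fst) t, (red \<circ> snd) t) \<in> L \<union> Id" by simp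
        qed (auto intro: congruence_sym[OF L] congruence_trans[OF L])
        moreover have "(red (snd s), red (snd s)) \<in> L"
          by (rule congruence_trans[OF L rL(2,1)]) (rule sd[OF s])+
        ultimately have "(red (fst s), red (snd s)) \<in> L" by auto
        then have "(fst s, snd s) \<in> L"
          using rL(1)[of "fst s"] rL(2)[of "snd s"] sd[OF s]
          by (blast intro: congruence_trans[OF L])
        then have "s \<in> ?hull (S - {s})" by (simp add: L_def)
        then have "?hull (insert s (S - {s})) = ?hull (S - {s})"
          by (rule hull_redundant)
        moreover have "insert s (S - {s}) = S" "S - {s} \<subset> S" using s by (auto simp: deg_def)
        ultimately show False using hS min by metis
      qed
    qed
    \<comment> \<open>The normal tuple of weight \<open>b\<close> is the one vertex by which a
      forest has more vertices than edges.\<close>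
    moreover have "card V \<le> card (T b) + 1"
      unfolding V_def using card_normal_weight[of b] card_Un_le[of "T b" "{t. normal t \<and> weight t = b}"]
      by linarith
    ultimately show ?thesis by simp
  qed simp
  \<comment> \<open>Finiteness of \<open>S\<close> is not assumed; it follows because only the
    finitely many weights of minimal non-normal tuples carry generators.\<close>
  have empty: "deg b = {}" if "b \<notin> weight ` min_nonnormal" for b
  proof -
    have "T b = {}" using that by (auto simp: T_def)
    then show ?thesis using main[of b] by auto
  qed
  have Seq: "S = (\<Union>b\<in>weight ` min_nonnormal. deg b)"
  proof
    show "S \<subseteq> (\<Union>b\<in>weight ` min_nonnormal. deg b)"
    proof
      fix s assume "s \<in> S"
      then have s: "s \<in> deg (weight (fst s))" by (simp add: deg_def)
      with empty have "weight (fst s) \<in> weight ` min_nonnormal" by blast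
      then show "s \<in> (\<Union>b\<in>weight ` min_nonnormal. deg b)" using s by (rule UN_I)
    qed
  qed (auto simp: deg_def)
  have "card S \<le> (\<Sum>b\<in>weight ` min_nonnormal. card (deg b))"
    by (subst Seq) (rule card_UN_le, use fin in simp)
  also have "\<dots> \<le> (\<Sum>b\<in>weight ` min_nonnormal. card (T b))"
    using main by (intro sum_mono) auto
  also have "\<dots> = card min_nonnormal"
    using sum.image_gen[OF fin, of "\<lambda>_. 1::nat" weight] by (simp add: T_def)
  finally show ?thesis using Seq main fin by (metis finite_UN finite_imageI)
qed

text \<open>A relation obtained by adding nonzero relations cannot reach an element of
  \<open>U\<close> from another tuple, since the intermediate sums would share support with it. So
  elements of \<open>U\<close> are joined to their fibres only by generators themselves. Collapsing
  everything outside \<open>U\<close> to \<open>None\<close> gives a graph with edges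
  \<open>S\<close> connecting \<open>card U + 1\<close> vertices.\<close>

lemma card_isolated_le:
  assumes S: "tuple_congruence n hull S = ker" "finite S" and U: "finite U" "U \<subseteq> tuples n"
    and iso: "\<And>u v i. u \<in> U \<Longrightarrow> v \<in> tuples n \<Longrightarrow> weight v = weight u \<Longrightarrow> v i > 0 \<Longrightarrow> u i > 0 \<Longrightarrow> v = u"
    and out: "\<And>u. u \<in> U \<Longrightarrow> \<exists>v\<in>tuples n. weight v = weight u \<and> v \<notin> U"
  shows "card U \<le> card S"
proof -
  define h where "h a = (if a \<in> U then Some a else None)" for a
  let ?C = "conn S (h \<circ> fst) (h \<circ> snd)"
  define R where "R = {(a, b) \<in> ker. (h a, h b) \<in> ?C}"
  have Sk: "S \<subseteq> ker" using hull_subset[of S "tuple_congruence n"] S(1) by simp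
  have nz: "\<exists>i. a i > 0" if "a \<noteq> 0" for a :: "nat \<Rightarrow> nat"
    using that by (auto simp: fun_eq_iff)
  \<comment> \<open>\<open>b + c\<close> shares the support of \<open>c\<close> with
    \<open>a + c\<close>, and \<open>b + d\<close> shares that of \<open>b\<close> with
    \<open>b + c\<close>; isolation makes all three equal.\<close>
  have eq: "a + c = b + d" if abcd: "(a, b) \<in> ker" "(c, d) \<in> ker" "a + c \<in> U" "a \<noteq> 0" "c \<noteq> 0" for a b c d
  proof -
    have t: "a \<in> tuples n" "b \<in> tuples n" "c \<in> tuples n" "d \<in> tuples n"
      and w: "weight a = weight b" "weight c = weight d" using abcd by (auto simp: ker_def)
    have b0: "b \<noteq> 0" using weight_eq_0_iff[OF t(1)] w abcd(4) by auto
    obtain i where "c i > 0" using nz abcd(5) by blast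
    then have 1: "b + c = a + c"
      using iso[OF abcd(3), of "b + c" i] t w by simp
    obtain j where "b j > 0" using nz b0 by blast
    then have "b + d = b + c"
      using iso[of "b + c" "b + d" j] t w abcd(3) 1 by simp
    with 1 show ?thesis by simp
  qed
  have "tuple_congruence n R"
  proof (rule tuple_congruenceI)
    fix a b c d assume ab: "(a, b) \<in> R" and cd: "(c, d) \<in> R"
    have k: "(a, b) \<in> ker" "(c, d) \<in> ker" using ab cd by (auto simp: R_def)
    then have k': "(a + c, b + d) \<in> ker" using congruence_add[OF congruence_ker] by blast
    have z: "a = 0 \<longleftrightarrow> b = 0" "c = 0 \<longleftrightarrow> d = 0"
      using k weight_eq_0_iff by (auto simp: ker_def)
    have "(h (a + c), h (b + d)) \<in> ?C"
    proof (cases "a = 0 \<or> c = 0")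
      case True
      then show ?thesis using z ab cd by (auto simp: R_def)
    next
      case False
      have "a + c = b + d" if "a + c \<in> U \<or> b + d \<in> U"
        using that eq[OF k] eq[of b a d c] False z k congruence_sym[OF congruence_ker] by metis
      then show ?thesis by (metis conn_refl h_def)
    qed
    then show "(a + c, b + d) \<in> R" using k' by (simp add: R_def)
  next
    fix a b c assume "(a, b) \<in> R" "(b, c) \<in> R"
    then show "(a, c) \<in> R"
      unfolding R_def by (auto intro: congruence_trans[OF congruence_ker] conn_trans)
  qed (auto simp: R_def ker_def intro: conn_sym)
  moreover have "S \<subseteq> R" using Sk conn_base[of _ S "h \<circ> fst" "h \<circ> snd"] by (fastforce simp: R_def)
  ultimately have kR: "ker \<subseteq> R" using hull_minimal[of S R "tuple_congruence n"] S(1) by simp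
  \<comment> \<open>The assumption \<open>out\<close> gives each \<open>u\<close> a partner that is
    collapsed to \<open>None\<close>.\<close>
  have star: "(Some u, None) \<in> ?C" if "u \<in> U" for u
  proof -
    from out[OF that] obtain v where "v \<in> tuples n" "weight v = weight u" "v \<notin> U" by blast
    then have "(u, v) \<in> ker" using U that by (auto simp: ker_def)
    then show ?thesis using kR \<open>v \<notin> U\<close> that by (auto simp: R_def h_def)
  qed
  have "card (insert None (Some ` U)) \<le> card S + 1"
    using S(2)
  proof (rule card_connected)
    fix x y assume "x \<in> insert None (Some ` U)" "y \<in> insert None (Some ` U)"
    then have "(x, None) \<in> ?C" "(y, None) \<in> ?C" using star by auto
    then show "(x, y) \<in> ?C" using conn_trans conn_sym by metis
  qed (use U in simp)
  moreover have "card (insert None (Some ` U)) = card U + 1"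
    using U by (subst card_insert_disjoint) (auto simp: card_image)
  ultimately show ?thesis by simp
qed

end

subsection \<open>Minimal generators of a numerical monoid\<close>

definition irreducibles :: "nat set \<Rightarrow> nat set" where
  "irreducibles X = {x \<in> X. x \<noteq> 0 \<and> (\<forall>y\<in>X. \<forall>z\<in>X. x = y + z \<longrightarrow> y = 0 \<or> z = 0)}"

lemma submonoid_sum:
  assumes "add_submonoid X" "finite A" "\<And>i. i \<in> A \<Longrightarrow> f i \<in> X"
  shows "(\<Sum>i\<in>A. f i) \<in> X"
  using assms(2,3) by induction (use assms(1) in \<open>auto simp: add_submonoid_def\<close>)

lemma submonoid_times:
  assumes "add_submonoid X" "x \<in> X"
  shows "k * x \<in> (X :: nat set)"
  by (induction k) (use assms in \<open>auto simp: add_submonoid_def\<close>)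

lemma irreducibles_hull:
  assumes X: "add_submonoid X"
  shows "add_submonoid hull irreducibles X = X"
proof
  show "add_submonoid hull irreducibles X \<subseteq> X"
    using X by (intro hull_minimal) (auto simp: irreducibles_def)
  have "x \<in> X \<Longrightarrow> x \<in> add_submonoid hull irreducibles X" for x
  proof (induction x rule: less_induct)
    case (less x)
    show ?case
    proof (cases "x = 0 \<or> x \<in> irreducibles X")
      case True
      then show ?thesis by (auto simp: hull_def add_submonoid_def)
    next
      case False
      then obtain y z where yz: "y \<in> X" "z \<in> X" "x = y + z" "y \<noteq> 0" "z \<noteq> 0"
        using less.prems by (auto simp: irreducibles_def)
      then have "y \<in> add_submonoid hull irreducibles X" "z \<in> add_submonoid hull irreducibles X"
        using less.IH by auto
      then show ?thesis using yz(3) by (auto simp: hull_def add_submonoid_def)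
    qed
  qed
  then show "X \<subseteq> add_submonoid hull irreducibles X" by blast
qed

text \<open>Removing an irreducible element from \<open>X\<close> leaves a submonoid, so a
  generating set cannot avoid it.\<close>

lemma irreducibles_subset:
  assumes G: "add_submonoid hull G = X" and X: "add_submonoid X"
  shows "irreducibles X \<subseteq> G"
proof
  fix x assume x: "x \<in> irreducibles X"
  show "x \<in> G"
  proof (rule ccontr)
    assume "x \<notin> G"
    then have "G \<subseteq> X - {x}" using G hull_subset[of G add_submonoid] by blast
    moreover have "add_submonoid (X - {x})"
      unfolding add_submonoid_def
    proof (intro conjI ballI)
      show "0 \<in> X - {x}" using X x by (auto simp: add_submonoid_def irreducibles_def)
    next
      fix y z assume yz: "y \<in> X - {x}" "z \<in> X - {x}"
      have "y + z \<noteq> x"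
      proof
        assume "y + z = x"
        then have "y = 0 \<or> z = 0" using x yz unfolding irreducibles_def by blast
        then show False using yz \<open>y + z = x\<close> by auto
      qed
      then show "y + z \<in> X - {x}" using X yz by (simp add: add_submonoid_def)
    qed
    ultimately have "X \<subseteq> X - {x}" using G hull_minimal[of G "X - {x}" add_submonoid] by simp
    then show False using x by (auto simp: irreducibles_def)
  qed
qed

text \<open>The irreducibles generate and lie in every generating set, so they form the least one,
  which settles existence and uniqueness for the definite description.\<close>

lemma min_gens_eq:
  assumes X: "add_submonoid X"
  shows "min_gens X = irreducibles X"
  unfolding min_gens_def
proof (rule the_equality)
  show "minimal_generating add_submonoid X (irreducibles X)"
    unfolding minimal_generating_def
  proof (intro conjI allI impI notI)
    fix H assume "H \<subset> irreducibles X" "add_submonoid hull H = X"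
    then show False using irreducibles_subset[OF _ X] by blast
  qed (rule irreducibles_hull[OF X])
next
  fix G assume G: "minimal_generating add_submonoid X G"
  then have "irreducibles X \<subseteq> G"
    using irreducibles_subset[OF _ X] by (simp add: minimal_generating_def)
  then show "G = irreducibles X"
    using G irreducibles_hull[OF X] by (auto simp: minimal_generating_def)
qed

subsection \<open>The upper bound\<close>

lemma size_less_2: "size M < 2 \<Longrightarrow> M = {#} \<or> (\<exists>x. M = {#x#})"
  by (metis One_nat_def less_2_cases size_1_singleton_mset size_eq_0_iff_empty)

text \<open>\<open>g_irreducible\<close> expresses that the weights are distinct minimal generators:
  the unit tuple is the only factorization of \<open>g i\<close>.\<close>

locale embedded = graded +
  assumes n_pos: "0 < n"
    and g_irreducible: "a \<in> tuples n \<Longrightarrow> i < n \<Longrightarrow> weight a = g i \<Longrightarrow> a = count {#i#}"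
begin

text \<open>These are the standard monomials in the variables other than \<open>0\<close>. Their
  weights form the Apery set of the generated monoid with respect to \<open>g 0\<close>.\<close>

definition std :: "nat multiset set" where
  "std = {M. set_mset M \<subseteq> {1..<n} \<and> normal (count M)}"

text \<open>If two weights differ by \<open>k * g 0\<close>, then \<open>k\<close> copies of index
  \<open>0\<close> added to the lighter multiset give a tuple in the fibre of the heavier one. For
  \<open>k > 0\<close> it is lexicographically larger, contradicting normality.\<close>

lemma inj_on_std: "inj_on (\<lambda>M. weight (count M) mod g 0) std"
proof -
  have *: "M = N" if M: "M \<in> std" and N: "N \<in> std"
    and eq: "weight (count M) mod g 0 = weight (count N) mod g 0"
    and le: "weight (count M) \<le> weight (count N)" for M N
  proof -
    obtain k where k: "weight (count N) = weight (count M) + k * g 0"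
      using eq le by (metis mod_eq_nat2E mult.commute)
    define a where "a = count (M + replicate_mset k 0)"
    have 0: "count M 0 = 0" "count N 0 = 0" using M N by (auto simp: std_def count_eq_zero_iff)
    have a: "a \<in> tuples n" "weight a = weight (count N)"
      using M n_pos k unfolding a_def count_plus weight_add weight_replicate[OF n_pos]
      by (auto simp: std_def normal_def tuples_count_iff)
    have "k = 0"
    proof (rule ccontr)
      assume "k \<noteq> 0"
      then have "count N 0 < a 0" using 0 by (simp add: a_def)
      then have "less_fun (count N) a" by (auto simp: less_fun_def)
      then show False using N a by (auto simp: std_def normal_def)
    qed
    then show ?thesis
      using M N k normal_unique[of "count M" "count N"] by (simp add: std_def count_inject)
  qed
  show ?thesis by (rule inj_onI) (metis * nle_le)
qed

lemma std_bound: "finite std" "card std \<le> g 0"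
proof -
  have 1: "(\<lambda>M. weight (count M) mod g 0) ` std \<subseteq> {..<g 0}" using g_pos n_pos by auto
  show "finite std" using inj_on_finite[OF inj_on_std 1] by simp
  show "card std \<le> g 0" using card_inj_on_le[OF inj_on_std 1] by simp
qed

lemma normal_single: "i < n \<Longrightarrow> normal (count {#i#})"
  unfolding normal_def using g_irreducible weight_count_single less_fun_irrefl
  by (metis lessThan_iff set_mset_single singletonD subsetI tuples_count_iff)

lemma std_subset: "M + N \<in> std \<Longrightarrow> M \<in> std"
  using normal_addD[of "count M" "count N"] by (auto simp: std_def count_plus)

lemma std_empty: "{#} \<in> std"
  using normal_single[OF n_pos] normal_addD[of "count {#}" "count {#0#}"]
  by (auto simp: std_def count_plus[symmetric])

lemma std_small: "{M \<in> std. size M < 2} = insert {#} ((\<lambda>i. {#i#}) ` {1..<n})"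
proof
  show "{M \<in> std. size M < 2} \<subseteq> insert {#} ((\<lambda>i. {#i#}) ` {1..<n})"
  proof
    fix M assume M: "M \<in> {M \<in> std. size M < 2}"
    then have "M = {#} \<or> (\<exists>x. M = {#x#})" by (intro size_less_2) simp
    then show "M \<in> insert {#} ((\<lambda>i. {#i#}) ` {1..<n})"
      using M by (auto simp: std_def)
  qed
  show "insert {#} ((\<lambda>i. {#i#}) ` {1..<n}) \<subseteq> {M \<in> std. size M < 2}"
    using std_empty normal_single by (auto simp: std_def)
qed

definition corners :: "nat multiset set" where
  "corners = {M. set_mset M \<subseteq> {1..<n} \<and> M \<notin> std \<and> (\<forall>x\<in>#M. M - {#x#} \<in> std)}"

text \<open>Consequently a minimal non-normal tuple does not involve the index \<open>0\<close>.\<close>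

lemma normal_add_0:
  assumes "normal a"
  shows "normal (a + count {#0#})"
  unfolding normal_def
proof (intro conjI ballI impI notI)
  show "a + count {#0#} \<in> tuples n"
    using assms n_pos by (simp add: normal_def tuples_count_iff del: count_single)
next
  fix b assume b: "b \<in> tuples n" "weight b = weight (a + count {#0#})" "less_fun (a + count {#0#}) b"
  then have "b 0 \<ge> 1"
    unfolding less_fun_def by (metis One_nat_def Suc_leI add_gr_0 count_single gr_zeroI le_add2
        less_imp_Suc_add not_less_zero plus_fun_apply zero_less_Suc)
  define c where "c i = (if i = 0 then b 0 - 1 else b i)" for i
  have bc: "b = c + count {#0#}" using \<open>b 0 \<ge> 1\<close> by (auto simp: c_def fun_eq_iff)
  have "less_fun a c" using b(3) unfolding bc by (auto simp: less_fun_def)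
  moreover have "c \<in> tuples n" "weight c = weight a" using b(1,2) unfolding bc by auto
  ultimately show False using assms by (auto simp: normal_def)
qed

lemma min_nonnormal_corners: "min_nonnormal \<subseteq> count ` corners"
proof
  fix u assume u: "u \<in> min_nonnormal"
  then obtain M where M: "u = count M" "set_mset M \<subseteq> {..<n}"
    using tuples_multiset by (auto simp: min_nonnormal_def)
  have sub: "normal (count N)" if "M = add_mset x N" for x N
  proof -
    have "u = count N + count {#x#}" using that M(1) by (auto simp: fun_eq_iff)
    moreover have "count {#x#} \<noteq> 0" by (auto simp: fun_eq_iff)
    ultimately show ?thesis using u by (auto simp: min_nonnormal_def)
  qed
  have "0 \<notin># M"
  proof
    assume "0 \<in># M"
    then obtain N where N: "M = add_mset 0 N" by (auto dest: multi_member_split)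
    have "u = count N + count {#0#}" using N M(1) by (auto simp: fun_eq_iff)
    then have "normal u" using normal_add_0[OF sub[OF N]] by simp
    then show False using u by (simp add: min_nonnormal_def)
  qed
  then have M1: "set_mset M \<subseteq> {1..<n}" using M(2) by (auto simp: Suc_le_eq intro!: gr0I)
  moreover have "M \<notin> std" using u M by (auto simp: std_def min_nonnormal_def)
  moreover have "M - {#x#} \<in> std" if "x \<in># M" for x
    using sub[of x "M - {#x#}"] M1 that by (auto simp: std_def dest: in_diffD)
  ultimately show "u \<in> count ` corners" using M by (auto simp: corners_def)
qed

text \<open>Corners and standard monomials of degree at least two are disjoint, and together they
  fit into all monomials of degree two and those of higher degree with every predecessor in
  \<open>P\<close>. As only \<open>card P \<le> g 0 - n\<close> is known, the last step uses that
  \<open>macaulay_shift x 2 - x\<close> does not decrease with \<open>x\<close>.\<close>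

lemma card_min_nonnormal:
  "finite min_nonnormal"
  "card min_nonnormal + (g 0 - n) \<le> (n choose 2) + macaulay_shift (g 0 - n) 2" "n \<le> g 0"
proof -
  define P where "P = {M \<in> std. size M \<ge> 2}"
  define W where "W = {u :: nat multiset. size u \<ge> 3 \<and> (\<forall>x\<in>#u. u - {#x#} \<in> P)}"
  define D where "D = multisets_of_size {1..<n} 2"
  have fP: "finite P" using std_bound by (simp add: P_def)
  have W: "finite W" "card W \<le> macaulay_shift (card P) 2"
    using card_upper_shadow_mixed[OF fP] by (auto simp: W_def P_def)
  have fD: "finite D" by (simp add: D_def finite_multisets_of_size)
  have "card D = (n choose 2)" using n_pos by (simp add: D_def card_multisets_of_size)
  have sz: "size M \<ge> 2" if M: "M \<in> corners" for M
  proof (rule ccontr)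
    assume "\<not> size M \<ge> 2"
    then have "M = {#} \<or> (\<exists>x. M = {#x#})" by (intro size_less_2) simp
    then have "M \<in> {M \<in> std. size M < 2}"
      unfolding std_small using M by (auto simp: corners_def)
    then show False using M by (simp add: corners_def)
  qed
  have sub: "corners \<union> P \<subseteq> D \<union> W"
  proof
    fix M assume M: "M \<in> corners \<union> P"
    show "M \<in> D \<union> W"
    proof (cases "size M = 2")
      case True
      then show ?thesis using M by (auto simp: D_def multisets_of_size_def corners_def P_def std_def)
    next
      case False
      then have s: "size M \<ge> 3" using M sz by (fastforce simp: P_def)
      have "M - {#x#} \<in> std" if "x \<in># M" for x
        using M that std_subset[of "M - {#x#}" "{#x#}"] by (auto simp: corners_def P_def)
      then have "M \<in> W" using s by (auto simp: W_def P_def size_Diff_singleton)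
      then show ?thesis ..
    qed
  qed
  have fC: "finite corners" using sub fD W by (meson finite_Un finite_subset)
  have "card corners + card P = card (corners \<union> P)"
    using fC fP by (intro card_Un_disjoint[symmetric]) (auto simp: corners_def P_def)
  also have "\<dots> \<le> card (D \<union> W)" using sub fD W by (intro card_mono) auto
  also have "\<dots> \<le> card D + card W" by (rule card_Un_le)
  finally have le: "card corners + card P \<le> (n choose 2) + macaulay_shift (card P) 2"
    using W \<open>card D = _\<close> by simp
  have "card std = card P + n"
  proof -
    have "std = P \<union> {M \<in> std. size M < 2}" by (auto simp: P_def)
    moreover have "card (P \<union> {M \<in> std. size M < 2}) = card P + card {M \<in> std. size M < 2}"
      using fP std_bound by (intro card_Un_disjoint) (auto simp: P_def)
    moreover have "card {M \<in> std. size M < 2} = n"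
    proof -
      have "inj_on (\<lambda>i. {#i#}) {1..<n}" by (auto simp: inj_on_def)
      then show ?thesis unfolding std_small using n_pos
        by (subst card_insert_disjoint) (auto simp: card_image)
    qed
    ultimately show ?thesis by simp
  qed
  then have P: "card P \<le> g 0 - n" and "n \<le> g 0" using std_bound by auto
  then show "n \<le> g 0" by simp
  have "card min_nonnormal \<le> card (count ` corners)"
    using min_nonnormal_corners fC by (intro card_mono) auto
  also have "\<dots> \<le> card corners" using fC by (rule card_image_le)
  finally have "card min_nonnormal \<le> card corners" .
  then show "card min_nonnormal + (g 0 - n) \<le> (n choose 2) + macaulay_shift (g 0 - n) 2"
    using macaulay_shift_2_diff_mono[OF P] P le by linarith
  show "finite min_nonnormal" using min_nonnormal_corners fC by (meson finite_imageI finite_subset)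
qed

end

lemma embedded_monoid:
  assumes X: "add_submonoid X" and e: "edim X = n" "0 < n"
  shows "embedded n (gen X)" "gen X 0 = Defs.mult X" "graded.ker n (gen X) = ker_phi X"
proof -
  have fin: "finite (min_gens X)" using e by (metis card.infinite edim_def less_irrefl)
  let ?xs = "sorted_list_of_set (min_gens X)"
  have len: "length ?xs = n" using e by (simp add: edim_def)
  have gen: "gen X i \<in> irreducibles X" if "i < n" for i
  proof -
    have "gen X i \<in> set ?xs" unfolding gen_def by (rule nth_mem) (use len that in simp)
    then show ?thesis using fin min_gens_eq[OF X] by simp
  qed
  interpret graded n "gen X"
    by standard (use gen in \<open>auto simp: irreducibles_def\<close>)
  have wX: "weight a \<in> X" for a
    unfolding weight_def
    by (intro submonoid_sum[OF X] submonoid_times[OF X]) (use gen in \<open>auto simp: irreducibles_def\<close>)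
  show "embedded n (gen X)"
  proof
    show "0 < n" by fact
  next
    fix a i assume a: "a \<in> tuples n" "i < n" "weight a = gen X i"
    obtain M where M: "a = count M" "set_mset M \<subseteq> {..<n}" using tuples_multiset[OF a(1)] .
    have "M \<noteq> {#}" using a(3) g_pos[OF a(2)] M(1) by (auto simp: weight_def)
    then obtain j N where N: "M = add_mset j N" by (cases M) auto
    have "a = count {#j#} + count N" using M N by (auto simp: fun_eq_iff)
    then have w: "weight a = weight (count {#j#}) + weight (count N)" by simp
    have j: "j < n" using M N by auto
    have wj: "weight (count {#j#}) = gen X j"
      using j by (simp add: weight_def if_distrib[of "\<lambda>x. x * _"] cong: if_cong)
    have "weight (count N) = 0"
      using gen[OF a(2)] w a(3) wX[of "count {#j#}"] wX[of "count N"] wj g_pos[OF j]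
      by (auto simp: irreducibles_def)
    moreover have "count N \<in> tuples n" using M N by (auto simp: tuples_count_iff)
    ultimately have "count N = 0" by (simp add: weight_eq_0_iff)
    then have "N = {#}" by (simp add: fun_eq_iff multiset_eq_iff)
    moreover have "gen X j = gen X i" using w wj a(3) \<open>weight (count N) = 0\<close> by simp
    then have "j = i"
      unfolding gen_def using j a(2) len
      by (simp add: nth_eq_iff_index_eq)
    ultimately show "a = count {#i#}" using M N by simp
  qed
  show "gen X 0 = Defs.mult X"
  proof -
    have ne: "min_gens X \<noteq> {}" using e by (auto simp: edim_def)
    have "gen X 0 \<in> min_gens X" using gen[OF e(2)] min_gens_eq[OF X] by simp
    moreover have "gen X 0 \<le> x" if "x \<in> min_gens X" for x
    proof -
      have "x \<in> set ?xs" using fin that by simp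
      then obtain i where "i < n" "?xs ! i = x" unfolding in_set_conv_nth len by auto
      then show ?thesis unfolding gen_def using len by (auto intro!: sorted_nth_mono)
    qed
    ultimately show ?thesis unfolding Defs.mult_def using fin by (metis Min_eqI)
  qed
  show "ker = ker_phi X"
    unfolding ker_def ker_phi_def by (simp add: e(1) weight_def phi_def)
qed

text \<open>The chosen generating set itself is returned, because the lower bound has to be applied
  to that same set.\<close>

lemma num_min_relations:
  assumes X: "add_submonoid X" and e: "edim X = n" "0 < n"
  obtains S where "finite S" "minimal_generating (tuple_congruence n) (ker_phi X) S"
    "num_min_relations X = card S"
    "card S + (Defs.mult X - n) \<le> (n choose 2) + macaulay_shift (Defs.mult X - n) 2" "n \<le> Defs.mult X"
proof -
  note em = embedded_monoid[OF assms]
  interpret embedded n "gen X" by (rule em(1))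
  define S where "S = (SOME S. minimal_generating (tuple_congruence n) ker S)"
  have "minimal_generating (tuple_congruence n) ker S"
    unfolding S_def by (rule someI_ex) (rule minimal_generating_exists[OF card_min_nonnormal(1)])
  then show ?thesis
    using that[of S] card_minimal_generating_le[OF card_min_nonnormal(1)] card_min_nonnormal(2,3)
      em(2,3) e(1)
    by (fastforce simp: num_min_relations_def S_def)
qed

subsection \<open>Numerical monoids attaining the bound\<close>

lemma power_3_sum_le:
  assumes "i \<le> j" "k \<le> l" "3 ^ i + 3 ^ j = 3 ^ k + (3 :: nat) ^ l"
  shows "j \<le> l"
proof (rule ccontr)
  assume "\<not> j \<le> l"
  then have "(3::nat) ^ Suc l \<le> 3 ^ j" by (intro power_increasing) auto
  moreover have "(3::nat) ^ k \<le> 3 ^ l" using assms(2) by (intro power_increasing) auto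
  moreover have "0 < (3::nat) ^ i" "0 < (3::nat) ^ l" by simp_all
  ultimately show False using assms(3) unfolding power_Suc by linarith
qed

lemma power_3_sum_inj_le:
  assumes "i \<le> j" "k \<le> l" "3 ^ i + 3 ^ j = 3 ^ k + (3 :: nat) ^ l"
  shows "i = k \<and> j = l"
proof -
  have "j = l"
    using power_3_sum_le[OF assms] power_3_sum_le[OF assms(2,1) assms(3)[symmetric]] by simp
  with assms(3) show ?thesis by simp
qed

text \<open>In base three two powers add without carry even when they are equal, so the digits of
  the sum recover the pair.\<close>

lemma power_3_sum_inj:
  assumes "3 ^ i + 3 ^ j = 3 ^ k + (3 :: nat) ^ l"
  shows "{#i, j#} = {#k, l#}"
proof -
  have 1: "3 ^ min i j + 3 ^ max i j = 3 ^ min k l + (3 :: nat) ^ max k l"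
    using assms by (simp add: min_def max_def)
  have "min i j = min k l \<and> max i j = max k l"
    using power_3_sum_inj_le[OF _ _ 1] by simp
  moreover have "{#i, j#} = {#min i j, max i j#}" "{#k, l#} = {#min k l, max k l#}"
    by (auto simp: min_def max_def)
  ultimately show ?thesis by simp
qed

lemma power_3_sum_neq: "3 ^ i + 3 ^ j \<noteq> (3 :: nat) ^ k"
proof
  assume eq: "3 ^ i + 3 ^ j = (3 :: nat) ^ k"
  define l where "l = max i j"
  have le: "(3::nat) ^ i \<le> 3 ^ l" "(3::nat) ^ j \<le> 3 ^ l"
    by (auto simp: l_def intro: power_increasing)
  have pos: "0 < (3::nat) ^ i" "0 < (3::nat) ^ j" by simp_all
  have "(3::nat) ^ l < 3 ^ i + 3 ^ j" using pos by (simp add: l_def max_def)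
  then have "(3::nat) ^ l < 3 ^ k" unfolding eq .
  then have "l < k" by (simp add: power_strict_increasing_iff)
  then have "(3::nat) ^ Suc l \<le> 3 ^ k" by (intro power_increasing) auto
  then show False using eq le pos unfolding power_Suc by linarith
qed

text \<open>These are the first \<open>(a choose 2) + b\<close> pairs when pairs are ordered by
  their larger entry. For \<open>b < a\<close> they attain equality in
  \<open>card_upper_shadow_2\<close>.\<close>

definition lex_pairs :: "nat \<Rightarrow> nat \<Rightarrow> nat multiset set" where
  "lex_pairs a b = multisets_of_size {1..<a} 2 \<union> (\<lambda>i. {#a, i#}) ` {1..b}"

lemma finite_lex_pairs: "finite (lex_pairs a b)"
  by (simp add: lex_pairs_def finite_multisets_of_size)

lemma card_lex_pairs:
  assumes "b < a"
  shows "card (lex_pairs a b) = (a choose 2) + b"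
proof -
  have "card (lex_pairs a b) = card (multisets_of_size {1..<a} 2) + card ((\<lambda>i. {#a, i#}) ` {1..b})"
    unfolding lex_pairs_def
    by (intro card_Un_disjoint finite_multisets_of_size) (auto simp: multisets_of_size_def)
  also have "card ((\<lambda>i. {#a, i#}) ` {1..b}) = b"
    by (subst card_image) (auto simp: inj_on_def)
  also have "card (multisets_of_size {1..<a} 2) = (a choose 2)"
    using assms by (simp add: card_multisets_of_size)
  finally show ?thesis .
qed

lemma lex_pairsE:
  assumes "M \<in> lex_pairs a b" "b < a"
  obtains x y where "M = {#x, y#}" "x \<in> {1..a}" "y \<in> {1..a}"
proof -
  have "size M = 2" "set_mset M \<subseteq> {1..a}"
    using assms by (auto simp: lex_pairs_def multisets_of_size_def)
  then obtain x N where "M = add_mset x N" "size N = 1"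
    by (metis Suc_1 size_Suc_Diff1 size_eq_Suc_imp_eq_union size_add_mset nat.inject One_nat_def)
  then show ?thesis using that \<open>set_mset M \<subseteq> {1..a}\<close> size_1_singleton_mset by force
qed

text \<open>The offsets \<open>3m\<close> and \<open>5m\<close> are chosen such that every generator is below \<open>6m\<close>, sums of two
  light generators lie between \<open>6m\<close> and \<open>7m\<close>, and all other sums of at least two generators
  different from \<open>m\<close> are at least \<open>8m\<close>.\<close>

locale extremal = graded +
  fixes a b m :: nat
  assumes b_less: "b < a" and m_large: "2 * 3 ^ a < m"
    and m_eq: "m = n + ((a choose 2) + b)" and a_less: "a < n"
    and g_0: "g 0 = m"
    and g_light: "i \<in> {1..a} \<Longrightarrow> g i = 3 * m + 3 ^ i"
    and g_heavy: "i \<in> {a<..<n} \<Longrightarrow> 5 * m \<le> g i"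
    and g_heavy_image: "(\<lambda>i. g i - 5 * m) ` {a<..<n} =
      {1..<m} - (\<lambda>i. 3 ^ i) ` {1..a} - (\<lambda>M. \<Sum>i\<in>#M. 3 ^ i) ` lex_pairs a b"
    and g_strict_mono: "strict_mono_on {..<n} g"
begin

abbreviation wt :: "nat multiset \<Rightarrow> nat" where
  "wt M \<equiv> weight (count M)"

lemma wt_empty [simp]: "wt {#} = 0"
  by (simp add: weight_def)

lemma n_pos: "0 < n"
  using a_less by simp

lemma m_pos: "0 < m"
  using m_large by simp

lemma light_less: "x \<in> {1..a} \<Longrightarrow> 2 * 3 ^ x < m"
proof -
  assume "x \<in> {1..a}"
  then have "(3::nat) ^ x \<le> 3 ^ a" by (intro power_increasing) auto
  then show ?thesis using m_large by linarith
qed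

lemma heavy_residue:
  assumes "i \<in> {a<..<n}"
  obtains c where "g i = 5 * m + c" "c \<in> {1..<m}" "\<forall>x\<in>{1..a}. c \<noteq> 3 ^ x"
    "\<forall>M\<in>lex_pairs a b. c \<noteq> (\<Sum>i\<in>#M. 3 ^ i)"
proof
  have c: "g i - 5 * m \<in> {1..<m} - (\<lambda>i. 3 ^ i) ` {1..a} - (\<lambda>M. \<Sum>i\<in>#M. 3 ^ i) ` lex_pairs a b"
    unfolding g_heavy_image[symmetric] using assms by (rule imageI)
  show "g i = 5 * m + (g i - 5 * m)" using g_heavy[OF assms] by simp
  show "g i - 5 * m \<in> {1..<m}" using c by blast
  show "\<forall>x\<in>{1..a}. g i - 5 * m \<noteq> 3 ^ x" using c by blast
  show "\<forall>M\<in>lex_pairs a b. g i - 5 * m \<noteq> (\<Sum>i\<in>#M. 3 ^ i)" using c by blast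
qed

lemma residue_bounds:
  assumes "i \<in> {1..<n}"
  shows "g i mod m \<noteq> 0" "3 * m \<le> g i" "g i < 6 * m"
    "M \<in> lex_pairs a b \<Longrightarrow> g i mod m \<noteq> (\<Sum>i\<in>#M. 3 ^ i)"
    "i \<le> a \<Longrightarrow> g i = 3 * m + g i mod m" "a < i \<Longrightarrow> g i = 5 * m + g i mod m"
proof -
  have "g i mod m \<noteq> 0 \<and> 3 * m \<le> g i \<and> g i < 6 * m \<and>
    (M \<in> lex_pairs a b \<longrightarrow> g i mod m \<noteq> (\<Sum>i\<in>#M. 3 ^ i)) \<and>
    (i \<le> a \<longrightarrow> g i = 3 * m + g i mod m) \<and> (a < i \<longrightarrow> g i = 5 * m + g i mod m)"
  proof (cases "i \<le> a")
    case True
    then have i: "i \<in> {1..a}" using assms by simp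
    have r: "g i mod m = 3 ^ i" using g_light[OF i] light_less[OF i] by simp
    have "3 ^ i \<noteq> (\<Sum>i\<in>#M. 3 ^ i :: nat)" if M: "M \<in> lex_pairs a b"
    proof -
      obtain x y where "M = {#x, y#}" using lex_pairsE[OF M b_less] .
      then show ?thesis using power_3_sum_neq[of x y i] by auto
    qed
    then show ?thesis using True r g_light[OF i] light_less[OF i] by auto
  next
    case False
    then have "i \<in> {a<..<n}" using assms by simp
    then obtain c where "g i = 5 * m + c" "c \<in> {1..<m}" "\<forall>x\<in>{1..a}. c \<noteq> 3 ^ x"
      "\<forall>M\<in>lex_pairs a b. c \<noteq> (\<Sum>i\<in>#M. 3 ^ i)"
      by (rule heavy_residue)
    then show ?thesis using False by auto
  qed
  then show "g i mod m \<noteq> 0" "3 * m \<le> g i" "g i < 6 * m"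
    "M \<in> lex_pairs a b \<Longrightarrow> g i mod m \<noteq> (\<Sum>i\<in>#M. 3 ^ i)"
    "i \<le> a \<Longrightarrow> g i = 3 * m + g i mod m" "a < i \<Longrightarrow> g i = 5 * m + g i mod m" by blast+
qed

text \<open>Light residues are powers of three, which were removed from the heavy residues; among
  generators of one kind the residue determines the weight.\<close>

lemma residue_inj:
  assumes i: "i \<in> {1..<n}" and j: "j \<in> {1..<n}" and eq: "g i mod m = g j mod m"
  shows "i = j"
proof -
  have *: False if h: "i \<in> {1..a}" "j \<in> {a<..<n}" "g i mod m = g j mod m" for i j
  proof -
    obtain c where c: "g j = 5 * m + c" "c \<in> {1..<m}" "\<forall>x\<in>{1..a}. c \<noteq> 3 ^ x"
      "\<forall>M\<in>lex_pairs a b. c \<noteq> (\<Sum>i\<in>#M. 3 ^ i)"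
      by (rule heavy_residue[OF h(2)])
    show False using bspec[OF c(3) h(1)] c(1,2) h(3) g_light[OF h(1)] light_less[OF h(1)] by simp
  qed
  have "g i = g j"
  proof (cases "i \<le> a"; cases "j \<le> a")
    assume "i \<le> a" "j \<le> a"
    then show ?thesis using residue_bounds(5)[OF i] residue_bounds(5)[OF j] eq by simp
  next
    assume "\<not> i \<le> a" "\<not> j \<le> a"
    then show ?thesis using residue_bounds(6)[OF i] residue_bounds(6)[OF j] eq by simp
  next
    assume "i \<le> a" "\<not> j \<le> a"
    then show ?thesis using *[of i j] i j eq by simp
  next
    assume "\<not> i \<le> a" "j \<le> a"
    then show ?thesis using *[of j i] i j eq by simp
  qed
  then show ?thesis using strict_mono_on_imp_inj_on[OF g_strict_mono] i j by (auto dest: inj_onD)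
qed

section \<open>Factorizations of small weight\<close>

lemma wt_lower: "set_mset M \<subseteq> {1..<n} \<Longrightarrow> 3 * m * size M \<le> wt M"
proof (induction M)
  case (add x M)
  then show ?case using residue_bounds(2)[of x] by (simp add: weight_add_mset del: count_add_mset)
qed simp

lemma split_0:
  assumes "set_mset M \<subseteq> {..<n}"
  obtains N k where "M = N + replicate_mset k 0" "set_mset N \<subseteq> {1..<n}" "wt M = wt N + k * m"
proof
  let ?N = "filter_mset (\<lambda>x. x \<noteq> 0) M"
  show eq: "M = ?N + replicate_mset (count M 0) 0"
    by (rule multiset_eqI) auto
  show "set_mset ?N \<subseteq> {1..<n}" using assms by auto
  show "wt M = wt ?N + count M 0 * m"
    by (subst eq) (simp only: count_plus weight_add weight_replicate[OF n_pos] g_0)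
qed

text \<open>Every generator is below \<open>6 * m\<close>, while two generators other than
  \<open>m\<close> already weigh at least that much. So at most one such generator occurs, and
  \<open>residue_inj\<close> identifies it.\<close>

lemma weight_generator_unique:
  assumes M: "set_mset M \<subseteq> {..<n}" and i: "i < n" and eq: "wt M = g i"
  shows "M = {#i#}"
proof -
  obtain N k where N: "M = N + replicate_mset k 0" "set_mset N \<subseteq> {1..<n}" "wt M = wt N + k * m"
    using split_0[OF M] .
  have low: "3 * m * size N \<le> g i" using wt_lower[OF N(2)] N(3) eq by simp
  show ?thesis
  proof (cases "i = 0")
    case True
    then have "3 * m * size N \<le> m" using low g_0 by simp
    then have "size N = 0" using m_pos by (cases "size N") auto
    then show ?thesis using True N eq g_0 m_pos by (cases k) (auto simp: fun_eq_iff)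
  next
    case False
    then have i1: "i \<in> {1..<n}" using i by simp
    have "3 * m * size N < 3 * m * 2" using low residue_bounds(3)[OF i1] by linarith
    then have "size N < 2" by (simp only: mult_less_cancel1)
    then consider "size N = 0" | "size N = 1" by linarith
    then show ?thesis
    proof cases
      case 1
      then have "g i = k * m" using N eq by simp
      then show ?thesis using residue_bounds(1)[OF i1] by simp
    next
      case 2
      then obtain x where x: "N = {#x#}" using size_1_singleton_mset by blast
      then have xn: "x \<in> {1..<n}" using N by simp
      have w: "g i = g x + k * m" using N eq x xn weight_count_single[of x] by simp
      then have "x = i" using residue_inj[OF xn i1] by simp
      then show ?thesis using w x N m_pos by simp
    qed
  qed
qed

lemma wt_light_pair:
  assumes "x \<in> {1..a}" "y \<in> {1..a}"
  shows "wt {#x, y#} = 6 * m + (3 ^ x + 3 ^ y)" "3 ^ x + 3 ^ y < m"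
proof -
  have "x < n" "y < n" using assms a_less by auto
  then show "wt {#x, y#} = 6 * m + (3 ^ x + 3 ^ y)"
    using assms by (simp add: weight_add_mset weight_count_single g_light del: count_add_mset)
  show "3 ^ x + 3 ^ y < m" using light_less[OF assms(1)] light_less[OF assms(2)] by linarith
qed

lemma wt_heavy_pair:
  assumes "x \<in> {1..<n}" "y \<in> {1..<n}" "a < x \<or> a < y"
  shows "8 * m \<le> wt {#x, y#}"
proof -
  have "wt {#x, y#} = g x + g y"
    using assms by (simp add: weight_add_mset weight_count_single del: count_add_mset)
  then show ?thesis
    using assms(3) residue_bounds(2,6)[OF assms(1)] residue_bounds(2,6)[OF assms(2)] by linarith
qed

lemma size_2E:
  assumes "size M = 2"
  obtains x y where "M = {#x, y#}"
proof -
  obtain x N where "M = add_mset x N" using assms by (cases M) auto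
  moreover from this have "size N = 1" using assms by simp
  then obtain y where "N = {#y#}" using size_1_singleton_mset by blast
  ultimately show ?thesis using that by simp
qed

text \<open>The weight is below \<open>7 * m\<close>, which excludes three generators other than
  \<open>m\<close> and pairs with a heavy one. At most one such generator is excluded by residues,
  and a light pair is recovered from its sum of powers of three.\<close>

lemma weight_lex_pair_unique:
  assumes M: "set_mset M \<subseteq> {..<n}" and p: "p \<in> lex_pairs a b" and eq: "wt M = wt p"
  shows "M = p"
proof -
  obtain i j where ij: "p = {#i, j#}" "i \<in> {1..a}" "j \<in> {1..a}" using lex_pairsE[OF p b_less] .
  note wp = wt_light_pair[OF ij(2,3)]
  obtain N k where N: "M = N + replicate_mset k 0" "set_mset N \<subseteq> {1..<n}" "wt M = wt N + k * m"
    using split_0[OF M] .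
  have w: "wt N + k * m = 6 * m + (3 ^ i + 3 ^ j)" using N(3) eq wp(1) ij(1) by simp
  have sp: "(\<Sum>i\<in>#p. 3 ^ i) = (3 ^ i + 3 ^ j :: nat)" by (simp add: ij(1))
  have md: "(wt N + k * m) mod m = 3 ^ i + 3 ^ j" unfolding w using wp(2) by simp
  have "3 * m * size N < 3 * m * 3" using wt_lower[OF N(2)] w wp(2) by linarith
  then have "size N < 3" by (simp only: mult_less_cancel1)
  then consider "size N = 0" | "size N = 1" | "size N = 2" by linarith
  then show ?thesis
  proof cases
    case 1
    then have "0 = (3 ^ i + 3 ^ j :: nat)" using md by simp
    then show ?thesis by simp
  next
    case 2
    then obtain x where x: "N = {#x#}" using size_1_singleton_mset by blast
    then have xn: "x \<in> {1..<n}" using N by simp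
    have "wt N = g x" using x xn weight_count_single[of x] by simp
    then show ?thesis using residue_bounds(4)[OF xn p] md sp by simp
  next
    case 3
    then obtain x y where xy: "N = {#x, y#}" by (rule size_2E)
    have xn: "x \<in> {1..<n}" "y \<in> {1..<n}" using N xy by auto
    have "\<not> (a < x \<or> a < y)"
    proof
      assume "a < x \<or> a < y"
      then have "8 * m \<le> wt N" using wt_heavy_pair[OF xn] xy by simp
      then show False using w wp(2) by linarith
    qed
    then have l: "x \<in> {1..a}" "y \<in> {1..a}" using xn by auto
    have wN: "wt N = 6 * m + (3 ^ x + 3 ^ y)" using wt_light_pair(1)[OF l] xy by simp
    have "3 ^ x + 3 ^ y = (3 ^ i + 3 ^ j :: nat)"
      using md unfolding wN using wt_light_pair(2)[OF l] by simp
    then have "N = p" "k * m = 0" using power_3_sum_inj[of x y i j] xy ij w wN by simp_all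
    then show ?thesis using N m_pos by simp
  qed
qed

lemma heavy_exists:
  assumes "c \<in> {1..<m}" "\<And>x. x \<in> {1..a} \<Longrightarrow> c \<noteq> 3 ^ x"
    "\<And>M. M \<in> lex_pairs a b \<Longrightarrow> c \<noteq> (\<Sum>i\<in>#M. 3 ^ i)"
  obtains i where "i \<in> {a<..<n}" "g i = 5 * m + c"
proof -
  have "c \<in> (\<lambda>i. g i - 5 * m) ` {a<..<n}" unfolding g_heavy_image using assms by blast
  then show ?thesis using that g_heavy by fastforce
qed

lemma residue_exists:
  assumes "c < m"
  obtains M where "set_mset M \<subseteq> {..<n}" "wt M < 7 * m" "wt M mod m = c"
proof (cases "c = 0")
  case True
  have "wt {#} = 0" by (simp add: weight_def)
  then show ?thesis using that[of "{#}"] True m_pos by simp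
next
  case False
  show ?thesis
  proof (cases "\<exists>M\<in>lex_pairs a b. c = (\<Sum>i\<in>#M. 3 ^ i)")
    case True
    then obtain M where M: "M \<in> lex_pairs a b" "c = (\<Sum>i\<in>#M. 3 ^ i)" by blast
    obtain i j where ij: "M = {#i, j#}" "i \<in> {1..a}" "j \<in> {1..a}" using lex_pairsE[OF M(1) b_less] .
    then show ?thesis using that[of M] wt_light_pair[OF ij(2,3)] M(2) a_less by simp
  next
    case nP: False
    show ?thesis
    proof (cases "\<exists>x\<in>{1..a}. c = 3 ^ x")
      case True
      then obtain x where x: "x \<in> {1..a}" "c = 3 ^ x" by blast
      then show ?thesis
        using that[of "{#x#}"] weight_count_single[of x] g_light[OF x(1)] a_less assms by simp
    next
      case False
      obtain i where "i \<in> {a<..<n}" "g i = 5 * m + c"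
        using heavy_exists[of c] nP False \<open>c \<noteq> 0\<close> assms by (metis One_nat_def Suc_leI atLeastLessThan_iff gr0I)
      then show ?thesis
        using that[of "{#i#}"] weight_count_single[of i] assms by simp
    qed
  qed
qed

text \<open>Every residue class is reached below \<open>7 * m\<close>, and copies of
  \<open>m\<close> fill the difference; at least one copy is needed.\<close>

lemma large_weight:
  assumes "7 * m \<le> t"
  obtains M where "set_mset M \<subseteq> {..<n}" "0 \<in># M" "wt M = t"
proof -
  obtain N where N: "set_mset N \<subseteq> {..<n}" "wt N < 7 * m" "wt N mod m = t mod m"
    using residue_exists[of "t mod m"] m_pos by auto
  then obtain k where k: "t = wt N + k * m"
    using assms by (metis less_imp_le less_le_trans mod_eq_nat2E mult.commute)
  have "k \<noteq> 0" using k N(2) assms by (cases k) auto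
  have w: "wt (N + replicate_mset k 0) = t"
    by (simp only: count_plus weight_add weight_replicate[OF n_pos] g_0 k)
  show ?thesis
    by (rule that[OF _ _ w]) (use N n_pos \<open>k \<noteq> 0\<close> in auto)
qed

text \<open>These are the corners of the order ideal consisting of \<open>1\<close>, the variables
  and \<open>lex_pairs a b\<close>. The last two families are the monomials of degree three with
  every predecessor in \<open>lex_pairs a b\<close>.\<close>

definition corner_set :: "nat multiset set" where
  "corner_set = (multisets_of_size {1..<n} 2 - lex_pairs a b) \<union> multisets_of_size {1..<a} 3 \<union>
    add_mset a ` multisets_of_size {1..b} 2"

text \<open>The two families of degree three have \<open>Suc a choose 3\<close> and
  \<open>Suc b choose 2\<close> members, the two terms of the shift.\<close>

lemma card_corner_set:
  "finite corner_set"
  "card corner_set + ((a choose 2) + b) = (n choose 2) + macaulay_shift ((a choose 2) + b) 2"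
proof -
  let ?A = "multisets_of_size {1..<n} 2" and ?B = "multisets_of_size {1..<a} 3"
    and ?C = "add_mset a ` multisets_of_size {1..b} 2"
  show "finite corner_set" by (simp add: corner_set_def finite_multisets_of_size)
  have sub: "lex_pairs a b \<subseteq> ?A"
    using a_less b_less by (auto simp: lex_pairs_def multisets_of_size_def)
  have "card corner_set = card (?A - lex_pairs a b) + card ?B + card ?C"
    unfolding corner_set_def
    by (subst card_Un_disjoint, simp_all add: finite_multisets_of_size, force simp: multisets_of_size_def)+
  moreover have "card (?A - lex_pairs a b) + ((a choose 2) + b) = (n choose 2)"
    using n_pos card_mono[OF finite_multisets_of_size sub] sub
    by (simp add: card_Diff_subset finite_lex_pairs card_lex_pairs[OF b_less] card_multisets_of_size)
  moreover have "card ?B = (Suc a choose 3)"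
    using b_less by (simp add: card_multisets_of_size)
  moreover have "card ?C = (Suc b choose 2)"
    by (subst card_image) (auto simp: inj_on_def card_multisets_of_size)
  ultimately show "card corner_set + ((a choose 2) + b) = (n choose 2) + macaulay_shift ((a choose 2) + b) 2"
    using macaulay_shift_2[of b a] b_less by simp
qed

lemma corner_set_support:
  assumes "u \<in> corner_set"
  shows "set_mset u \<subseteq> {1..<n}"
  using assms a_less b_less by (fastforce simp: corner_set_def multisets_of_size_def)

text \<open>A corner of weight below \<open>7 * m\<close> is a light pair outside
  \<open>lex_pairs a b\<close>. Its residue \<open>c\<close> then belongs to a heavy generator
  \<open>5 * m + c\<close>, and adding the generator \<open>m\<close> gives the weight
  \<open>6 * m + c\<close> of the pair.\<close>

lemma corner_set_other:
  assumes u: "u \<in> corner_set"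
  obtains M where "set_mset M \<subseteq> {..<n}" "0 \<in># M" "wt M = wt u"
proof -
  note su = corner_set_support[OF u]
  show ?thesis
  proof (cases "7 * m \<le> wt u")
    case True
    then show ?thesis using large_weight that by blast
  next
    case False
    have "3 * m * size u < 3 * m * 3" using wt_lower[OF su] False m_pos by linarith
    then have "size u < 3" by (simp only: mult_less_cancel1)
    then have s: "size u = 2" and nP: "u \<notin> lex_pairs a b"
      using u by (auto simp: corner_set_def multisets_of_size_def)
    obtain x y where xy: "u = {#x, y#}" using size_2E[OF s] .
    have xn: "x \<in> {1..<n}" "y \<in> {1..<n}" using su xy by auto
    have l: "x \<in> {1..a}" "y \<in> {1..a}" using wt_heavy_pair[OF xn] False xn xy m_pos by fastforce+
    note w = wt_light_pair[OF l]
    have "3 ^ x + 3 ^ y \<noteq> (\<Sum>i\<in>#M. 3 ^ i :: nat)" if M: "M \<in> lex_pairs a b" for M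
    proof
      assume eq: "3 ^ x + 3 ^ y = (\<Sum>i\<in>#M. 3 ^ i :: nat)"
      obtain i j where ij: "M = {#i, j#}" using lex_pairsE[OF M b_less] .
      then have "u = M" using eq power_3_sum_inj[of x y i j] xy by simp
      then show False using nP M by simp
    qed
    then obtain i where i: "i \<in> {a<..<n}" "g i = 5 * m + (3 ^ x + 3 ^ y)"
      using heavy_exists[of "3 ^ x + 3 ^ y"] w(2) power_3_sum_neq by (auto simp: Suc_le_eq)
    have "wt {#i, 0#} = wt u"
      using i n_pos w(1) xy by (simp add: weight_add_mset weight_count_single g_0 del: count_add_mset)
    then show ?thesis using that[of "{#i, 0#}"] i n_pos by auto
  qed
qed

text \<open>Cancelling the common index \<open>i\<close> leaves a single generator or a member of
  \<open>lex_pairs a b\<close>, both of which factor uniquely.\<close>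

lemma corner_set_isolated:
  assumes u: "u \<in> corner_set" and v: "set_mset v \<subseteq> {..<n}" "wt v = wt u" "i \<in># v" "i \<in># u"
  shows "v = u"
proof -
  obtain u' v' where uv: "u = add_mset i u'" "v = add_mset i v'"
    using v(3,4) by (meson multi_member_split)
  have i: "i < n" using v by auto
  have eq: "wt v' = wt u'" using v(2) i by (simp add: uv weight_add_mset del: count_add_mset)
  have sv: "set_mset v' \<subseteq> {..<n}" using v(1) uv by auto
  have "u \<in> multisets_of_size {1..<n} 2 \<or> u' \<in> lex_pairs a b"
  proof (cases "u \<in> multisets_of_size {1..<n} 2")
    case False
    then consider "u \<in> multisets_of_size {1..<a} 3" | p where "u = add_mset a p" "p \<in> multisets_of_size {1..b} 2"
      using u by (auto simp: corner_set_def)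
    then show ?thesis
    proof cases
      case 1
      then show ?thesis using uv by (auto simp: lex_pairs_def multisets_of_size_def)
    next
      case 2
      show ?thesis
      proof (cases "i = a")
        case True
        then have "u' = p" using 2 uv by simp
        then show ?thesis using 2 b_less by (fastforce simp: lex_pairs_def multisets_of_size_def)
      next
        case False
        then obtain q where q: "p = add_mset i q" "u' = add_mset a q"
          using 2 uv by (metis add_eq_conv_ex)
        then have "size q = 1" using 2 by (simp add: multisets_of_size_def)
        then obtain j where "q = {#j#}" using size_1_singleton_mset by blast
        then show ?thesis using q 2 by (auto simp: lex_pairs_def multisets_of_size_def)
      qed
    qed
  qed simp
  then have "v' = u'"
  proof
    assume A: "u \<in> multisets_of_size {1..<n} 2"
    then have "size u' = 1" using uv by (simp add: multisets_of_size_def)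
    then obtain j where j: "u' = {#j#}" using size_1_singleton_mset by blast
    have jn: "j < n" using A uv j by (simp add: multisets_of_size_def)
    then show ?thesis using weight_generator_unique[OF sv jn] eq j weight_count_single[OF jn] by simp
  next
    assume "u' \<in> lex_pairs a b"
    then show ?thesis using weight_lex_pair_unique[OF sv] eq by blast
  qed
  then show ?thesis using uv by simp
qed

section \<open>The monoid generated by the extremal weights\<close>

definition monoid :: "nat set" where
  "monoid = weight ` tuples n"

lemma submonoid_monoid: "add_submonoid monoid"
  unfolding add_submonoid_def monoid_def
proof (intro conjI ballI)
  show "0 \<in> weight ` tuples n" by (rule image_eqI[of _ _ 0]) simp_all
  fix x y assume "x \<in> weight ` tuples n" "y \<in> weight ` tuples n"
  then obtain c d where "x = weight c" "y = weight d" "c \<in> tuples n" "d \<in> tuples n" by blast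
  then show "x + y \<in> weight ` tuples n" by (intro image_eqI[of _ _ "c + d"]) simp_all
qed

lemma numerical_monoid: "numerical_monoid monoid"
proof -
  have "UNIV - monoid \<subseteq> {..<7 * m}"
  proof
    fix t assume t: "t \<in> UNIV - monoid"
    show "t \<in> {..<7 * m}"
    proof (rule ccontr)
      assume "t \<notin> {..<7 * m}"
      then obtain M where "set_mset M \<subseteq> {..<n}" "wt M = t" using large_weight[of t] by auto
      then have "t \<in> monoid" unfolding monoid_def using tuples_count_iff by blast
      then show False using t by simp
    qed
  qed
  then show ?thesis
    using submonoid_monoid finite_subset by (auto simp: numerical_monoid_def)
qed

lemma generator_in_monoid: "i < n \<Longrightarrow> g i \<in> monoid"
  unfolding monoid_def
  by (rule image_eqI[of _ _ "count {#i#}"])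
    (simp_all add: weight_count_single tuples_count_iff del: count_add_mset)

lemma min_gens_monoid: "min_gens monoid = g ` {..<n}"
  unfolding min_gens_eq[OF submonoid_monoid]
proof
  show "irreducibles monoid \<subseteq> g ` {..<n}"
  proof
    fix t assume t: "t \<in> irreducibles monoid"
    then obtain c where c: "c \<in> tuples n" "t = weight c" by (auto simp: irreducibles_def monoid_def)
    obtain M where M: "c = count M" "set_mset M \<subseteq> {..<n}" using tuples_multiset[OF c(1)] .
    have "M \<noteq> {#}" using t c(2) M(1) by (auto simp: irreducibles_def weight_def)
    then obtain i N where N: "M = add_mset i N" by (cases M) auto
    have i: "i < n" using N M by simp
    have tw: "t = g i + wt N" using c(2) M(1) N weight_add_mset[OF i] by simp
    have "wt N \<in> monoid" unfolding monoid_def using M N by (auto simp: tuples_count_iff)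
    then have "wt N = 0"
      using t tw generator_in_monoid[OF i] g_pos[OF i] by (auto simp: irreducibles_def)
    then show "t \<in> g ` {..<n}" using tw i by simp
  qed
  show "g ` {..<n} \<subseteq> irreducibles monoid"
  proof
    fix t assume "t \<in> g ` {..<n}"
    then obtain i where i: "i < n" "t = g i" by blast
    have "y = 0 \<or> z = 0" if yz: "y \<in> monoid" "z \<in> monoid" "g i = y + z" for y z
    proof -
      obtain c d where cd: "c \<in> tuples n" "d \<in> tuples n" "y = weight c" "z = weight d"
        using yz by (auto simp: monoid_def)
      obtain M N where MN: "c = count M" "set_mset M \<subseteq> {..<n}" "d = count N" "set_mset N \<subseteq> {..<n}"
        using tuples_multiset[OF cd(1)] tuples_multiset[OF cd(2)] by metis
      have "wt (M + N) = g i" unfolding count_plus weight_add using yz(3) cd MN by simp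
      then have "M + N = {#i#}" using weight_generator_unique[of "M + N" i] MN i by simp
      then have "M = {#} \<or> N = {#}" by (metis union_is_single)
      then show ?thesis using cd MN by (auto simp: weight_def)
    qed
    then show "t \<in> irreducibles monoid"
      using i generator_in_monoid[OF i(1)] g_pos[OF i(1)] by (auto simp: irreducibles_def)
  qed
qed

lemma edim_monoid: "edim monoid = n"
  unfolding edim_def min_gens_monoid
  by (simp add: card_image strict_mono_on_imp_inj_on[OF g_strict_mono])

lemma gen_monoid: "i < n \<Longrightarrow> gen monoid i = g i"
proof -
  assume i: "i < n"
  have "sorted_wrt (<) (map g [0..<n])"
    unfolding sorted_wrt_map
    by (rule sorted_wrt_mono_rel[OF _ sorted_wrt_upt])
      (use g_strict_mono in \<open>auto simp: strict_mono_on_def\<close>)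
  then have "sorted_list_of_set (set (map g [0..<n])) = map g [0..<n]"
    by (intro sorted_list_of_set.idem_if_sorted_distinct) (auto simp: strict_sorted_iff)
  moreover have "set (map g [0..<n]) = g ` {..<n}" by auto
  ultimately show ?thesis using i by (simp add: gen_def min_gens_monoid)
qed

lemma mult_monoid: "Defs.mult monoid = m"
  using embedded_monoid(2)[OF submonoid_monoid edim_monoid n_pos] gen_monoid[OF n_pos] g_0 by simp

lemma ker_phi_monoid: "ker_phi monoid = ker"
  by (simp add: ker_phi_def ker_def phi_def weight_def edim_monoid gen_monoid)

lemma num_min_relations_monoid:
  "(n choose 2) + macaulay_shift ((a choose 2) + b) 2 \<le> num_min_relations monoid + ((a choose 2) + b)"
proof -
  obtain S where S: "finite S" "minimal_generating (tuple_congruence n) (ker_phi monoid) S"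
    "num_min_relations monoid = card S"
    using num_min_relations[OF submonoid_monoid edim_monoid n_pos] by metis
  have "card (count ` corner_set) \<le> card S"
  proof (rule card_isolated_le)
    show "tuple_congruence n hull S = ker"
      using S(2) by (simp add: ker_phi_monoid minimal_generating_def)
    show "finite S" by fact
    show "finite (count ` corner_set)" using card_corner_set by simp
    show "count ` corner_set \<subseteq> tuples n"
      using corner_set_support by (fastforce simp: tuples_count_iff)
  next
    fix u v i assume uv: "u \<in> count ` corner_set" "v \<in> tuples n" "weight v = weight u" "v i > 0" "u i > 0"
    obtain M where M: "M \<in> corner_set" "u = count M" using uv(1) by blast
    obtain N where N: "v = count N" "set_mset N \<subseteq> {..<n}" using tuples_multiset[OF uv(2)] .
    show "v = u" using corner_set_isolated[OF M(1) N(2), of i] uv M N by simp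
  next
    fix u assume "u \<in> count ` corner_set"
    then obtain M where M: "M \<in> corner_set" "u = count M" by blast
    obtain N where N: "set_mset N \<subseteq> {..<n}" "0 \<in># N" "wt N = wt M" using corner_set_other[OF M(1)] .
    \<comment> \<open>Corners avoid index \<open>0\<close>, which occurs in
      \<open>N\<close>.\<close>
    have "count N \<notin> count ` corner_set"
      using N(2) corner_set_support by (fastforce simp: count_inject)
    then show "\<exists>v\<in>tuples n. weight v = weight u \<and> v \<notin> count ` corner_set"
      using N M by (intro bexI[of _ "count N"]) (auto simp: tuples_count_iff)
  qed
  moreover have "card (count ` corner_set) = card corner_set"
    by (rule card_image) (simp add: inj_on_def count_inject)
  ultimately show ?thesis using S(3) card_corner_set(2) by linarith
qed

end

lemma extremal_monoid_exists:
  assumes ab: "b < a" and m: "m = n + ((a choose 2) + b)" "2 * 3 ^ a < m"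
  obtains X where "numerical_monoid X" "edim X = n" "Defs.mult X = m"
    "(n choose 2) + macaulay_shift ((a choose 2) + b) 2 \<le> num_min_relations X + ((a choose 2) + b)"
proof -
  define L where "L = (\<lambda>i. 3 ^ i :: nat) ` {1..a}"
  define Q where "Q = (\<lambda>M. \<Sum>i\<in>#M. 3 ^ i :: nat) ` lex_pairs a b"
  define R where "R = {1..<m} - L - Q"
  define zs where "zs = sorted_list_of_set R"
  have pw: "2 * 3 ^ x < m" if "x \<in> {1..a}" for x
  proof -
    have "(3::nat) ^ x \<le> 3 ^ a" using that by (intro power_increasing) auto
    then show ?thesis using m(2) by linarith
  qed
  have LQ: "L \<inter> Q = {}"
  proof -
    have "3 ^ i \<noteq> (\<Sum>i\<in>#M. 3 ^ i :: nat)" if M: "M \<in> lex_pairs a b" for i M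
    proof -
      obtain x y where "M = {#x, y#}" using lex_pairsE[OF M ab] .
      then show ?thesis using power_3_sum_neq[of x y i] by auto
    qed
    then show ?thesis by (auto simp: L_def Q_def)
  qed
  have Lsub: "L \<subseteq> {1..<m}" using pw by (fastforce simp: L_def)
  have Qsub: "Q \<subseteq> {1..<m}"
  proof
    fix c assume "c \<in> Q"
    then obtain M where M: "M \<in> lex_pairs a b" "c = (\<Sum>i\<in>#M. 3 ^ i)" by (auto simp: Q_def)
    obtain x y where "M = {#x, y#}" "x \<in> {1..a}" "y \<in> {1..a}" using lex_pairsE[OF M(1) ab] .
    then show "c \<in> {1..<m}" using pw[of x] pw[of y] M(2) by (auto simp: Suc_le_eq)
  qed
  have cL: "card L = a"
    unfolding L_def by (subst card_image) (auto simp: inj_on_def)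
  have cQ: "card Q = (a choose 2) + b"
  proof -
    have "inj_on (\<lambda>M. \<Sum>i\<in>#M. 3 ^ i :: nat) (lex_pairs a b)"
    proof (rule inj_onI)
      fix M N assume MN: "M \<in> lex_pairs a b" "N \<in> lex_pairs a b" "(\<Sum>i\<in>#M. 3 ^ i :: nat) = (\<Sum>i\<in>#N. 3 ^ i)"
      obtain x y where "M = {#x, y#}" using lex_pairsE[OF MN(1) ab] .
      moreover obtain x' y' where "N = {#x', y'#}" using lex_pairsE[OF MN(2) ab] .
      ultimately show "M = N" using power_3_sum_inj[of x y x' y'] MN(3) by simp
    qed
    then show ?thesis by (simp add: Q_def card_image card_lex_pairs[OF ab])
  qed
  have cLQ: "card (L \<union> Q) = a + ((a choose 2) + b)"
    using LQ cL cQ by (subst card_Un_disjoint) (auto simp: L_def Q_def finite_lex_pairs)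
  have "card (L \<union> Q) \<le> card {1..<m}" using Lsub Qsub by (intro card_mono) auto
  then have an: "a < n" using cLQ m by simp
  have "card R = card ({1..<m} - (L \<union> Q))" by (simp add: R_def set_diff_eq)
  \<comment> \<open>By the choice of \<open>m\<close>, the remaining residues are exactly as many as
    the generators still missing after \<open>m\<close> and the \<open>a\<close> light ones.\<close>
  also have "\<dots> = n - 1 - a"
    using Lsub Qsub cLQ m by (subst card_Diff_subset) (auto simp: L_def Q_def finite_lex_pairs)
  finally have lz: "length zs = n - 1 - a" by (simp add: zs_def)
  have sz: "set zs = R" by (simp add: zs_def R_def)
  have dz: "zs ! i < zs ! j" if "i < j" "j < n - 1 - a" for i j
    using sorted_wrt_nth_less[of "(<)" zs i j] that lz by (simp add: zs_def)
  \<comment> \<open>Taking the heavy residues in increasing order makes \<open>g\<close> strictly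
    increasing, so it will agree with the sorted list of minimal generators.\<close>
  define g where "g i = (if i = 0 then m else if i \<le> a then 3 * m + 3 ^ i else 5 * m + zs ! (i - Suc a))" for i
  have mono: "g i < g j" if ij: "i < j" "j < n" for i j
  proof -
    have "m > 0" using m(2) by simp
    moreover have "3 * m + 3 ^ i < 5 * m" if "i \<noteq> 0" "i \<le> a" using pw[of i] that by simp
    moreover have "(3::nat) ^ i < 3 ^ j" using ij by simp
    moreover have "zs ! (i - Suc a) < zs ! (j - Suc a)" if "\<not> i \<le> a"
      using dz[of "i - Suc a" "j - Suc a"] ij that by auto
    ultimately show ?thesis using ij unfolding g_def by (auto split: if_splits)
  qed
  interpret extremal n g a b m
  proof
    show "strict_mono_on {..<n} g" using mono by (auto simp: strict_mono_on_def)
    show "g i > 0" for i using m(2) by (auto simp: g_def)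
    show "(\<lambda>i. g i - 5 * m) ` {a<..<n} =
      {1..<m} - (\<lambda>i. 3 ^ i) ` {1..a} - (\<lambda>M. \<Sum>i\<in>#M. 3 ^ i) ` lex_pairs a b"
    proof -
      have "(\<lambda>i. g i - 5 * m) ` {a<..<n} = (\<lambda>i. zs ! (i - Suc a)) ` {a<..<n}"
        by (intro image_cong) (auto simp: g_def)
      also have "\<dots> = (!) zs ` ((\<lambda>i. i - Suc a) ` {a<..<n})" by (simp add: image_image)
      also have "(\<lambda>i. i - Suc a) ` {a<..<n} = {..<length zs}"
        unfolding lz
      proof (intro equalityI subsetI)
        fix x assume "x \<in> {..<n - 1 - a}"
        then show "x \<in> (\<lambda>i. i - Suc a) ` {a<..<n}"
          by (intro image_eqI[of _ _ "x + Suc a"]) auto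
      qed auto
      also have "(!) zs ` {..<length zs} = R" using sz by (auto simp: set_conv_nth)
      finally show ?thesis by (simp add: R_def L_def Q_def)
    qed
  qed (use ab m an in \<open>auto simp: g_def\<close>)
  show ?thesis
    using that[OF numerical_monoid edim_monoid mult_monoid num_min_relations_monoid] .
qed

subsection \<open>The maximum\<close>

lemma max_relations_eq:
  assumes ab: "b < a" and m: "m = Suc e + ((a choose 2) + b)" "2 * 3 ^ a < m"
  shows "max_relations e m + ((a choose 2) + b) = (Suc e choose 2) + macaulay_shift ((a choose 2) + b) 2"
proof -
  let ?s = "(a choose 2) + b"
  let ?A = "{num_min_relations X | X. numerical_monoid X \<and> edim X = e + 1 \<and> Defs.mult X = m}"
  have up: "k + ?s \<le> (Suc e choose 2) + macaulay_shift ?s 2" if "k \<in> ?A" for k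
  proof -
    obtain X where X: "k = num_min_relations X" "numerical_monoid X" "edim X = Suc e" "Defs.mult X = m"
      using \<open>k \<in> ?A\<close> by auto
    then have "add_submonoid X" by (simp add: numerical_monoid_def)
    then obtain S where "finite S" "minimal_generating (tuple_congruence (Suc e)) (ker_phi X) S"
      "num_min_relations X = card S"
      "card S + (Defs.mult X - Suc e) \<le> (Suc e choose 2) + macaulay_shift (Defs.mult X - Suc e) 2" "Suc e \<le> Defs.mult X"
      by (rule num_min_relations[OF _ X(3) zero_less_Suc])
    then show ?thesis using X m by simp
  qed
  obtain X where X: "numerical_monoid X" "edim X = Suc e" "Defs.mult X = m"
    "(Suc e choose 2) + macaulay_shift ?s 2 \<le> num_min_relations X + ?s"
    using extremal_monoid_exists[OF ab m] .
  then have in_A: "num_min_relations X \<in> ?A" by auto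
  have "?A \<subseteq> {..(Suc e choose 2) + macaulay_shift ?s 2}" using up by fastforce
  then have fin: "finite ?A" by (rule finite_subset) simp
  have "Max ?A = num_min_relations X"
    using fin in_A by (intro Max_eqI) (use up X(4) in fastforce)+
  then show ?thesis using up[OF in_A] X(4) by (simp add: max_relations_def)
qed

lemma macaulay_r_eq_2:
  assumes "e + 1 \<le> m" "m < (e + 2) choose 2"
  shows "macaulay_r e m = 2"
  unfolding macaulay_r_def
proof (rule the_equality)
  show "1 \<le> (2::nat) \<and> (e + 2 - 1) choose (2 - 1) \<le> m \<and> m < (e + 2) choose 2"
    using assms by simp
next
  fix r assume r: "1 \<le> r \<and> (e + r - 1) choose (r - 1) \<le> m \<and> m < (e + r) choose r"
  have "r \<noteq> 1" using r assms(1) by auto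
  moreover have "\<not> 3 \<le> r"
  proof
    assume "3 \<le> r"
    \<comment> \<open>The common lower index \<open>e\<close> turns the comparison into monotonicity
      in the upper index.\<close>
    have "(e + 2) choose 2 = (e + 2) choose e" by (subst binomial_symmetric) auto
    also have "\<dots> \<le> (e + r - 1) choose e" using \<open>3 \<le> r\<close> by (intro binomial_right_mono) auto
    also have "\<dots> = (e + r - 1) choose (r - 1)" using \<open>3 \<le> r\<close> by (subst binomial_symmetric) auto
    finally show False using r assms(2) by simp
  qed
  ultimately show "r = 2" using r by linarith
qed

theorem theorem3p2:
  fixes \<delta> :: nat
  assumes "\<delta> \<ge> 1"
  shows "\<exists>M. \<forall>e m. 3 \<le> e \<and> e < m \<and> m - e = \<delta> \<and> m \<ge> M \<longrightarrow>
           int (max_relations e m) = relation_bound e m"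
proof -
  obtain a b where ab: "\<delta> - 1 = (a choose 2) + b" "b < a" by (rule choose_2_plus_exists)
  show ?thesis
  \<comment> \<open>The summand \<open>2 * 3 ^ a\<close> keeps sums of two powers of three below
    \<open>m\<close>. The rest ensures \<open>\<delta> \<le> e\<close>, hence
    \<open>m \<le> 2 * e\<close> and \<open>r = 2\<close>. Since \<open>a\<close> depends only on
    \<open>\<delta>\<close>, so does the bound.\<close>
  proof (rule exI[of _ "2 * 3 ^ a + 2 * \<delta> + 1"], intro allI impI)
    fix e m :: nat
    assume A: "3 \<le> e \<and> e < m \<and> m - e = \<delta> \<and> m \<ge> 2 * 3 ^ a + 2 * \<delta> + 1"
    then have m: "m = Suc e + ((a choose 2) + b)" "2 * 3 ^ a < m" and e: "\<delta> \<le> e" "3 \<le> e" "m = e + \<delta>"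
      using ab(1) assms by auto
    have "m \<le> 2 * e" using e by simp
    also have "\<dots> < (e + 2) choose 2" by (simp add: Suc_choose_2)
    finally have r: "macaulay_r e m = 2" using m by (intro macaulay_r_eq_2) auto
    then have s: "macaulay_s e m = (a choose 2) + b" using m by (simp add: macaulay_s_def)
    show "int (max_relations e m) = relation_bound e m"
      using max_relations_eq[OF ab(2) m] by (simp add: relation_bound_def r s)
  qed
qed

end
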